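(* Let $\rho:\mathbb{R}^d\to(0,\infty)$ be a critical radius function. Let $\theta\ge0$, $0\le\alpha<d$, $1\le p\le q<\infty$ be such that $1/p-1/q=\alpha/d$. Let $(U,V)$ be a pair of matrix weights. The following statements are equivalent: (1) $(U,V)\in\mathcal{A}_{p,q}^{\rho,\theta}$; (2) $\|A_Q^{\alpha,\theta}\vec f\|_{L^q(U)}\lesssim\|\vec f\|_{L^p(V^{p/q})}$ for all $\vec f\in L^p(V^{p/q})$, with constant independent of the cube $Q$ (and of $\vec f$). Moreover, one has the estimate $$\|A_Q^{\alpha,\theta}\vec f\|_{L^q(U)}\lesssim[U,V]_{\mathcal{A}_{p,q}^{\rho,\theta}}^{1/q}\|\vec f\|_{L^p(V^{p/q})},$$ with implicit constant independent of $Q$, $\vec f$, $U$, $V$.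
   Context: Critical radius function: $\rho:\mathbb{R}^d\to(0,\infty)$ for which there are constants $C_0,N_0>0$ with $C_0^{-1}\rho(x)(1+\frac{|x-y|}{\rho(x)})^{-N_0}\le\rho(y)\le C_0\rho(x)(1+\frac{|x-y|}{\rho(x)})^{\frac{N_0}{N_0+1}}$ for all $x,y\in\mathbb{R}^d$. For a cube $Q\subset\mathbb{R}^d$ with center $x_Q$ and side-length $l_Q$, $\psi_\theta(Q):=(1+l_Q/\rho(x_Q))^\theta$. A matrix weight $W:\mathbb{R}^d\to\mathbb{C}^{n\times n}$ is a self-adjoint matrix function with locally integrable entries which is positive definite almost everywhere; powers are defined by the spectral calculus. $|\cdot|_{op}$ is the operator norm. $L^r(W)$ is the space of measurable $\vec f:\mathbb{R}^d\to\mathbb{C}^n$ with $\|\vec f\|_{L^r(W)}:=(\int|W(x)^{1/r}\vec f(x)|^rdx)^{1/r}<\infty$; in particular $\|\vec f\|_{L^p(V^{p/q})}=(\int|V(x)^{1/q}\vec f(x)|^pdx)^{1/p}$. $(U,V)\in\mathcal{A}_{p,q}^{\rho,\theta}$ means that the following is finite (suprema over all cubes): for $1<p\le q<\infty$, $$[U,V]_{\mathcal{A}_{p,q}^{\rho,\theta}}:=\sup_Q\frac{1}{\psi_\theta(Q)|Q|}\int_Q\Big(\frac{1}{\psi_\theta(Q)|Q|}\int_Q|U(x)^{1/q}V(y)^{-1/q}|_{op}^{p'}dy\Big)^{q/p'}dx;$$ for $p=1\le q<\infty$, $$[U,V]_{\mathcal{A}_{1,q}^{\rho,\theta}}:=\sup_Q\operatorname*{ess\,sup}_{y\in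 Q}\frac{1}{\psi_\theta(Q)|Q|}\int_Q|U(x)^{1/q}V(y)^{-1/q}|_{op}^q\,dx.$$ The averaging operator is $$A_Q^{\alpha,\theta}\vec f(x):=\frac{1}{(\psi_\theta(Q)|Q|)^{1-\alpha/d}}\int_Q\vec f(y)dy\ \chi_Q(x).$$ *)

theory Defs
  imports "HOL-Analysis.Analysis" "HOL-Probability.Essential_Supremum"
begin

text \<open>Throughout, \<open>\<real>\<^sup>d\<close> is \<open>real ^ 'd\<close> with \<open>d = CARD('d)\<close>, and \<open>\<complex>\<^sup>n\<close> is \<open>complex ^ 'n\<close> with its
  Euclidean norm. Measurability and integrals refer to the completed Lebesgue measure.\<close>

text \<open>Nonnegative extended reals carry no real power in the library.
  The convention \<open>\<infinity>\<^sup>a = \<infinity>\<close> is the right one only for \<open>a > 0\<close>, the only case used below.\<close>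

definition epowr :: "ennreal \<Rightarrow> real \<Rightarrow> ennreal" where
  "epowr x a = (if x = \<infinity> then \<infinity> else ennreal (enn2real x powr a))"

definition critical_radius :: "(real ^ 'd \<Rightarrow> real) \<Rightarrow> bool" where
  "critical_radius \<rho> \<longleftrightarrow>
     (\<forall>x. 0 < \<rho> x) \<and>
     (\<exists>C0 > 0. \<exists>N0 > 0. \<forall>x y.
        inverse C0 * \<rho> x * (1 + norm (x - y) / \<rho> x) powr (- N0) \<le> \<rho> y \<and>
        \<rho> y \<le> C0 * \<rho> x * (1 + norm (x - y) / \<rho> x) powr (N0 / (N0 + 1)))"

text \<open>Cubes are closed, have sides parallel to the axes, and are given by centre \<open>c\<close> and
  side-length \<open>l\<close>; the condition \<open>l > 0\<close> is imposed wherever cubes are quantified over.\<close>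

definition cube :: "real ^ 'd \<Rightarrow> real \<Rightarrow> (real ^ 'd) set" where
  "cube c l = cbox (\<chi> i. c $ i - l / 2) (\<chi> i. c $ i + l / 2)"

definition psi :: "(real ^ 'd \<Rightarrow> real) \<Rightarrow> real \<Rightarrow> real ^ 'd \<Rightarrow> real \<Rightarrow> real" where
  "psi \<rho> \<theta> c l = (1 + l / \<rho> c) powr \<theta>"

definition psi_vol :: "(real ^ 'd \<Rightarrow> real) \<Rightarrow> real \<Rightarrow> real ^ 'd \<Rightarrow> real \<Rightarrow> real" where
  "psi_vol \<rho> \<theta> c l = psi \<rho> \<theta> c l * measure lebesgue (cube c l)"

definition cadjoint :: "complex ^ 'n ^ 'n \<Rightarrow> complex ^ 'n ^ 'n" where
  "cadjoint A = (\<chi> i j. cnj (A $ j $ i))"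

definition self_adjoint :: "complex ^ 'n ^ 'n \<Rightarrow> bool" where
  "self_adjoint A \<longleftrightarrow> cadjoint A = A"

text \<open>The quadratic form of a self-adjoint matrix is real valued, so taking the real part
  is harmless.\<close>

definition pos_definite :: "complex ^ 'n ^ 'n \<Rightarrow> bool" where
  "pos_definite A \<longleftrightarrow> self_adjoint A \<and>
     (\<forall>v. v \<noteq> 0 \<longrightarrow> 0 < Re (\<Sum>i\<in>UNIV. cnj (v $ i) * (A *v v) $ i))"

definition unitary_matrix :: "complex ^ 'n ^ 'n \<Rightarrow> bool" where
  "unitary_matrix S \<longleftrightarrow> S ** cadjoint S = mat 1 \<and> cadjoint S ** S = mat 1"

definition real_diag :: "('n \<Rightarrow> real) \<Rightarrow> complex ^ 'n ^ 'n" where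
  "real_diag \<mu> = (\<chi> i j. if i = j then complex_of_real (\<mu> i) else 0)"

text \<open>Spectral calculus: \<open>g(A) = S diag(g(\<mu>\<^sub>i)) S\<^sup>*\<close> whenever \<open>A = S diag(\<mu>\<^sub>i) S\<^sup>*\<close> with \<open>S\<close> unitary.
  For self-adjoint \<open>A\<close> such a diagonalisation exists and the result does not depend on it;
  for other \<open>A\<close> the value is unspecified.\<close>

definition spectral_fun :: "(real \<Rightarrow> real) \<Rightarrow> complex ^ 'n ^ 'n \<Rightarrow> complex ^ 'n ^ 'n" where
  "spectral_fun g A = (THE B. \<exists>S \<mu>. unitary_matrix S \<and>
      A = S ** real_diag \<mu> ** cadjoint S \<and>
      B = S ** real_diag (\<lambda>i. g (\<mu> i)) ** cadjoint S)"

definition mpowr :: "complex ^ 'n ^ 'n \<Rightarrow> real \<Rightarrow> complex ^ 'n ^ 'n" where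
  "mpowr A a = spectral_fun (\<lambda>t. t powr a) A"

definition matrix_opnorm :: "complex ^ 'n ^ 'n \<Rightarrow> real" where
  "matrix_opnorm A = onorm (\<lambda>v. A *v v)"

definition matrix_weight :: "(real ^ 'd \<Rightarrow> complex ^ 'n ^ 'n) \<Rightarrow> bool" where
  "matrix_weight W \<longleftrightarrow>
     (\<forall>x. self_adjoint (W x)) \<and>
     (\<forall>i j K. compact K \<longrightarrow> (\<lambda>x. W x $ i $ j) absolutely_integrable_on K) \<and>
     (AE x in lebesgue. pos_definite (W x))"

definition weighted_norm ::
    "real \<Rightarrow> (real ^ 'd \<Rightarrow> complex ^ 'n ^ 'n) \<Rightarrow> (real ^ 'd \<Rightarrow> complex ^ 'n) \<Rightarrow> ennreal" where
  "weighted_norm r W f =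
     epowr (\<integral>\<^sup>+ x. ennreal (norm (mpowr (W x) (1 / r) *v f x) powr r) \<partial>lebesgue) (1 / r)"

definition weighted_space ::
    "real \<Rightarrow> (real ^ 'd \<Rightarrow> complex ^ 'n ^ 'n) \<Rightarrow> (real ^ 'd \<Rightarrow> complex ^ 'n) set" where
  "weighted_space r W = {f \<in> borel_measurable lebesgue. weighted_norm r W f < \<infinity>}"

definition Apq_const ::
    "(real ^ 'd \<Rightarrow> real) \<Rightarrow> real \<Rightarrow> real \<Rightarrow> real \<Rightarrow>
     (real ^ 'd \<Rightarrow> complex ^ 'n ^ 'n) \<Rightarrow> (real ^ 'd \<Rightarrow> complex ^ 'n ^ 'n) \<Rightarrow> ennreal" where
  "Apq_const \<rho> \<theta> p q U V =
     (if p = 1 then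
        (SUP (c, l) \<in> UNIV \<times> {0<..}.
           esssup (restrict_space lebesgue (cube c l)) (\<lambda>y.
             ennreal (1 / psi_vol \<rho> \<theta> c l) *
             (\<integral>\<^sup>+ x \<in> cube c l.
                ennreal (matrix_opnorm (mpowr (U x) (1 / q) ** mpowr (V y) (- 1 / q)) powr q)
              \<partial>lebesgue)))
      else
        (let p' = p / (p - 1) in
         SUP (c, l) \<in> UNIV \<times> {0<..}.
           ennreal (1 / psi_vol \<rho> \<theta> c l) *
           (\<integral>\<^sup>+ x \<in> cube c l.
              epowr (ennreal (1 / psi_vol \<rho> \<theta> c l) *
                (\<integral>\<^sup>+ y \<in> cube c l.
                   ennreal (matrix_opnorm (mpowr (U x) (1 / q) ** mpowr (V y) (- 1 / q)) powr p')
                 \<partial>lebesgue)) (q / p')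
            \<partial>lebesgue)))"

definition Apq_class ::
    "(real ^ 'd \<Rightarrow> real) \<Rightarrow> real \<Rightarrow> real \<Rightarrow> real \<Rightarrow>
     ((real ^ 'd \<Rightarrow> complex ^ 'n ^ 'n) \<times> (real ^ 'd \<Rightarrow> complex ^ 'n ^ 'n)) set" where
  "Apq_class \<rho> \<theta> p q = {(U, V). Apq_const \<rho> \<theta> p q U V < \<infinity>}"

text \<open>The Bochner integral is \<open>0\<close> by convention if \<open>f\<close> is not integrable on the cube, so
  statements asserting that the operator is well defined need integrability separately.\<close>

definition averaging_op ::
    "(real ^ 'd \<Rightarrow> real) \<Rightarrow> real \<Rightarrow> real \<Rightarrow> real ^ 'd \<Rightarrow> real \<Rightarrow>
     (real ^ 'd \<Rightarrow> complex ^ 'n) \<Rightarrow> real ^ 'd \<Rightarrow> complex ^ 'n" where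
  "averaging_op \<rho> \<alpha> \<theta> c l f x =
     indicator (cube c l) x *\<^sub>R
       ((1 / psi_vol \<rho> \<theta> c l powr (1 - \<alpha> / real CARD('d))) *\<^sub>R
         set_lebesgue_integral lebesgue (cube c l) f)"

end

theory Submission
  imports Defs
begin

text \<open>Put \<open>X = U\<^sup>1\<^sup>/\<^sup>q\<close>, \<open>Y = V\<^sup>-\<^sup>1\<^sup>/\<^sup>q\<close>, \<open>Z = V\<^sup>1\<^sup>/\<^sup>q\<close>. Inserting \<open>Y Z = 1\<close> bounds the average of \<open>f\<close> by the
  kernel \<open>\<bar>X(x) Y(y)\<bar>\<close> acting on \<open>\<bar>Z(y) f(y)\<bar>\<close>; Hoelder's inequality (for \<open>p = 1\<close>: Jensen's inequality
  and Tonelli's theorem) then gives the estimate with constant \<open>1\<close>. Conversely, the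
  functional \<open>N(v) = (\<integral>\<^sub>Q \<bar>X v\<bar>\<^sup>q)\<^sup>1\<^sup>/\<^sup>q\<close> has an Auerbach basis \<open>B\<close> with coordinates \<open>T = B\<^sup>-\<^sup>1\<close>; boundedness of the
  averages and \<open>L\<^sup>p\<close> duality bound the rows of \<open>T Y\<close> in \<open>L\<^sup>p\<^sup>'(Q)\<close>, and \<open>\<bar>X(x) Y(y)\<bar> \<le> \<bar>X(x) B\<bar> \<bar>T Y(y)\<bar>\<close> separates
  the variables in the weight condition.\<close>

subsection \<open>Spectral calculus of self-adjoint matrices\<close>

text \<open>The obstacle in the converse is that, for fixed \<open>x\<close>, duality would estimate
  \<open>X(x) Y\<close> in \<open>y\<close> only by test functions depending on \<open>x\<close>,
  while the hypothesis controls the integral over \<open>x\<close> for one test function at a time.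
  A fixed pair \<open>B\<close>, \<open>T\<close> removes this dependence, since the rows of
  \<open>T Y\<close> do not involve \<open>x\<close>; the price is powers of the dimension
  \<open>n\<close>. The relation between \<open>p\<close>, \<open>q\<close> and \<alpha> says that
  \<open>q (1 - \<alpha> / d)\<close> equals \<open>1 + q / p'\<close>, and equals \<open>1\<close>
  if \<open>p = 1\<close>. So the \<open>q\<close>-th power of the normalisation of the average is
  exactly the product of the normalisations in the weight condition. They cancel, and each cube can
  be treated as an abstract finite measure space carrying the functions \<open>X\<close>,
  \<open>Y\<close>, \<open>Z\<close>. Integrability has to be carried along: the Bochner integral of
  a non-integrable function is \<open>0\<close>, so a norm bound alone would give no information
  about such \<open>f\<close>. The spectral part serves two ends: measurability of matrix powers,
  through their continuity on positive definite matrices, and local integrability of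
  \<open>norm (X v) powr q\<close>, through a comparison with the entries of the weight.\<close>

definition cdot :: "complex ^ 'n \<Rightarrow> complex ^ 'n \<Rightarrow> complex" where
  "cdot v w = (\<Sum>i\<in>UNIV. cnj (v $ i) * w $ i)"

lemma cdot_add_left: "cdot (u + v) w = cdot u w + cdot v w"
  by (simp add: cdot_def distrib_right sum.distrib)

lemma cdot_add_right: "cdot u (v + w) = cdot u v + cdot u w"
  by (simp add: cdot_def distrib_left sum.distrib)

lemma cdot_smult_left: "cdot (a *s v) w = cnj a * cdot v w"
  by (simp add: cdot_def sum_distrib_left mult.assoc)

lemma cdot_smult_right: "cdot v (a *s w) = a * cdot v w"
  by (simp add: cdot_def sum_distrib_left mult_ac)

lemmas cdot_simps = cdot_add_left cdot_add_right cdot_smult_left cdot_smult_right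

lemma cdot_commute: "cdot w v = cnj (cdot v w)"
  by (simp add: cdot_def mult.commute)

lemma cdot_self: "cdot v v = complex_of_real ((norm v)\<^sup>2)"
proof -
  have "(norm v)\<^sup>2 = (\<Sum>i\<in>UNIV. (cmod (v $ i))\<^sup>2)"
    by (simp add: norm_vec_def L2_set_def sum_nonneg)
  moreover have "cnj (v $ i) * v $ i = complex_of_real ((cmod (v $ i))\<^sup>2)" for i
    by (metis complex_norm_square mult.commute)
  ultimately show ?thesis by (simp add: cdot_def)
qed

lemma cdot_matrix_vector: "cdot v (A *v w) = cdot (cadjoint A *v v) w"
proof -
  have "cdot v (A *v w) = (\<Sum>i\<in>UNIV. \<Sum>j\<in>UNIV. cnj (v $ i) * (A $ i $ j * w $ j))"
    by (simp add: cdot_def matrix_vector_mult_def sum_distrib_left)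
  also have "\<dots> = (\<Sum>j\<in>UNIV. \<Sum>i\<in>UNIV. cnj (v $ i) * (A $ i $ j * w $ j))"
    by (rule sum.swap)
  also have "\<dots> = cdot (cadjoint A *v v) w"
    by (simp add: cdot_def matrix_vector_mult_def cadjoint_def sum_distrib_left mult_ac)
  finally show ?thesis .
qed

lemma cadjoint_mult: "cadjoint (A ** B) = cadjoint B ** cadjoint A"
  by (simp add: cadjoint_def matrix_matrix_mult_def vec_eq_iff mult.commute)

lemma cadjoint_cadjoint [simp]: "cadjoint (cadjoint A) = A"
  by (simp add: cadjoint_def vec_eq_iff)

text \<open>Reads conjugation by \<open>S\<close> as evaluation of a sesquilinear form on the
  columns of \<open>S\<close>. With \<open>A = mat 1\<close> it is the Gram matrix, so unitarity
  becomes orthonormality of the columns.\<close>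

lemma conjugate_entry:
  "(cadjoint S ** A ** S) $ k $ l = cdot (column k S) (A *v column l S)"
proof -
  have "(cadjoint S ** A ** S) $ k $ l = (\<Sum>j\<in>UNIV. (\<Sum>i\<in>UNIV. cnj (S $ i $ k) * A $ i $ j) * S $ j $ l)"
    by (simp add: matrix_matrix_mult_def cadjoint_def)
  also have "\<dots> = (\<Sum>i\<in>UNIV. \<Sum>j\<in>UNIV. cnj (S $ i $ k) * A $ i $ j * S $ j $ l)"
    by (subst sum.swap) (simp add: sum_distrib_right)
  also have "\<dots> = cdot (column k S) (A *v column l S)"
    by (simp add: cdot_def column_def matrix_vector_mult_def sum_distrib_left mult.assoc)
  finally show ?thesis .
qed

lemma unitary_matrix_iff_columns:
  "unitary_matrix S \<longleftrightarrow> (\<forall>k l. cdot (column k S) (column l S) = (if k = l then 1 else 0))"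
proof -
  have "(cadjoint S ** S) $ k $ l = cdot (column k S) (column l S)" for k l
    using conjugate_entry[of S "mat 1" k l] by simp
  then have "cadjoint S ** S = mat 1 \<longleftrightarrow>
      (\<forall>k l. cdot (column k S) (column l S) = (if k = l then 1 else 0))"
    by (simp add: vec_eq_iff mat_def)
  then show ?thesis
    using matrix_left_right_inverse[of S "cadjoint S"] by (auto simp: unitary_matrix_def)
qed

lemma unitary_entry_le:
  assumes "unitary_matrix S"
  shows "cmod (S $ i $ j) \<le> 1"
proof -
  have "complex_of_real ((norm (column j S))\<^sup>2) = 1"
    using assms unfolding cdot_self[symmetric] by (simp add: unitary_matrix_iff_columns)
  then have "(norm (column j S))\<^sup>2 = 1"
    by (simp only: of_real_eq_1_iff)
  then have "norm (column j S) = 1"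
    using norm_ge_zero[of "column j S"] by (auto simp: power2_eq_1_iff)
  then show ?thesis
    using Finite_Cartesian_Product.norm_nth_le[of "column j S" i] by (simp add: column_def)
qed

lemma norm_vec_le_sum: "norm (v :: 'a::real_normed_vector ^ 'n) \<le> (\<Sum>i\<in>UNIV. norm (v $ i))"
  by (simp add: norm_vec_def L2_set_le_sum)

lemma norm_matrix_le_sum:
  "norm (A :: 'a::real_normed_vector ^ 'n ^ 'm) \<le> (\<Sum>i\<in>UNIV. \<Sum>j\<in>UNIV. norm (A $ i $ j))"
  by (rule order_trans[OF norm_vec_le_sum]) (intro sum_mono norm_vec_le_sum)

lemma continuous_on_matrix_mult [continuous_intros]:
  fixes f :: "'x::topological_space \<Rightarrow> complex ^ 'n ^ 'm" and g :: "'x \<Rightarrow> complex ^ 'k ^ 'n"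
  assumes "continuous_on T f" "continuous_on T g"
  shows "continuous_on T (\<lambda>x. f x ** g x)"
  unfolding matrix_matrix_mult_def by (intro continuous_intros assms)

lemma continuous_on_cadjoint [continuous_intros]:
  assumes "continuous_on T f"
  shows "continuous_on T (\<lambda>x. cadjoint (f x))"
  unfolding cadjoint_def by (intro continuous_intros assms)

text \<open>Compactness is used twice: for the maximiser in \<open>unitary_diagonalization\<close>,
  and in \<open>mpowr_subseq_limit\<close> to extract a convergent subsequence of diagonalising
  matrices.\<close>

lemma compact_unitary_matrices: "compact {S :: complex ^ 'n ^ 'n. unitary_matrix S}"
proof -
  have "closed {S :: complex ^ 'n ^ 'n. unitary_matrix S}"
    unfolding unitary_matrix_def
    by (intro closed_Collect_conj closed_Collect_eq continuous_intros)
  moreover have "norm S \<le> (\<Sum>i\<in>(UNIV::'n set). \<Sum>j\<in>(UNIV::'n set). 1)"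
    if "unitary_matrix S" for S :: "complex ^ 'n ^ 'n"
    by (rule order_trans[OF norm_matrix_le_sum]) (intro sum_mono unitary_entry_le that)
  then have "bounded {S :: complex ^ 'n ^ 'n. unitary_matrix S}"
    unfolding bounded_iff by blast
  ultimately show ?thesis by (simp add: compact_eq_bounded_closed)
qed

text \<open>A Jacobi rotation in the plane of the coordinates \<open>i\<close> and \<open>j\<close> diagonalises that \<open>2 \<times> 2\<close> block, so
  the diagonal gains the squared modulus of the two annihilated entries. A maximiser over the compact
  unitary group therefore diagonalises \<open>A\<close>.\<close>

lemma jacobi_rotation:
  fixes S A :: "complex ^ 'n ^ 'n"
  assumes A: "self_adjoint A" and S: "unitary_matrix S" and ij: "i \<noteq> j"
    and nz: "(cadjoint S ** A ** S) $ i $ j \<noteq> 0"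
  shows "\<exists>T. unitary_matrix T \<and>
    (\<Sum>k\<in>UNIV. (Re ((cadjoint S ** A ** S) $ k $ k))\<^sup>2)
      < (\<Sum>k\<in>UNIV. (Re ((cadjoint T ** A ** T) $ k $ k))\<^sup>2)"
proof -
  define D where "D T k l = cdot (column k T) (A *v column l T)" for T :: "complex ^ 'n ^ 'n" and k l
  have D: "(cadjoint T ** A ** T) $ k $ l = D T k l" for T k l
    by (simp add: D_def conjugate_entry)
  have herm: "D T l k = cnj (D T k l)" for T k l
    using A unfolding D_def self_adjoint_def by (metis cdot_commute cdot_matrix_vector)
  define b where "b = D S i j"
  have b: "b \<noteq> 0" using nz by (simp add: D b_def)
  \<comment> \<open>The phase \<open>u\<close> turns the entry \<open>b\<close> into
    \<open>cmod b\<close>, so the block to be diagonalised is in effect the real symmetric one with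
    diagonal \<open>a\<close>, \<open>d\<close> and off-diagonal entry
    \<open>cmod b\<close>.\<close>
  define u where "u = cnj b / cmod b"
  have ub: "u * b = cmod b"
    using b by (simp add: u_def field_simps complex_norm_square[symmetric] power2_eq_square[symmetric])
  have uu: "u * cnj u = 1"
  proof -
    have "cmod u = 1" using b by (simp add: u_def norm_divide)
    then show ?thesis by (metis complex_norm_square of_real_1 one_power2)
  qed
  define a where "a = Re (D S i i)"
  define d where "d = Re (D S j j)"
  have aa: "D S i i = a" and dd: "D S j j = d"
    using herm[of S i i] herm[of S j j] by (auto simp: a_def d_def complex_eq_iff)
  \<comment> \<open>The eigenvalues of the block are \<open>(a + d) / 2 + r / 2\<close> and
    \<open>(a + d) / 2 - r / 2\<close>, so \<open>r\<close> is the spectral gap.\<close>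
  define r where "r = sqrt ((a - d)\<^sup>2 + 4 * (cmod b)\<^sup>2)"
  have r2: "r\<^sup>2 = (a - d)\<^sup>2 + 4 * (cmod b)\<^sup>2" by (simp add: r_def)
  have r: "r > 0" unfolding r_def real_sqrt_gt_0_iff using b by (intro add_nonneg_pos) auto
  define t where "t = (a - d) / r"
  have t: "- 1 \<le> t" "t \<le> 1"
  proof -
    have "\<bar>a - d\<bar> \<le> r" unfolding r_def by (rule real_le_rsqrt) simp
    then show "- 1 \<le> t" "t \<le> 1" using r by (auto simp: t_def field_simps)
  qed
  \<comment> \<open>Half-angle formulas: \<open>t\<close> is the cosine of twice the rotation angle,
    and \<open>c\<close>, \<open>s\<close> are the cosine and sine of the angle itself. The
    double-angle sine is then \<open>2 * cmod b / r\<close>.\<close>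
  define c where "c = sqrt ((1 + t) / 2)"
  define s where "s = sqrt ((1 - t) / 2)"
  have c2: "c\<^sup>2 = (1 + t) / 2" and s2: "s\<^sup>2 = (1 - t) / 2"
    using t by (simp_all add: c_def s_def)
  have cs1: "c\<^sup>2 + s\<^sup>2 = 1" by (simp add: c2 s2 field_simps)
  have cs: "2 * (c * s) = 2 * cmod b / r"
  proof -
    have "(2 * (c * s))\<^sup>2 = (2 * c\<^sup>2) * (2 * s\<^sup>2)" by (simp add: power2_eq_square)
    also have "\<dots> = 1 - t\<^sup>2" unfolding c2 s2 by (simp add: power2_eq_square field_simps)
    also have "\<dots> = (r\<^sup>2 - (a - d)\<^sup>2) / r\<^sup>2" using r by (simp add: t_def field_simps)
    also have "\<dots> = (2 * cmod b / r)\<^sup>2" unfolding r2 by (simp add: power_divide r2)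
    finally show ?thesis
      by (rule power2_eq_imp_eq) (use t r in \<open>auto simp: c_def s_def\<close>)
  qed
  have key: "t * (a - d) + 2 * (2 * cmod b / r * cmod b) = r"
  proof -
    have "t * (a - d) + 2 * (2 * cmod b / r * cmod b) = r\<^sup>2 / r"
      unfolding t_def r2 by (simp add: power2_eq_square add_divide_distrib)
    then show ?thesis using r by (simp add: power2_eq_square)
  qed
  have lin_i: "x = (1 + t) / 2 * a + (1 - t) / 2 * d + X \<Longrightarrow> t * (a - d) + 2 * X = r \<Longrightarrow> x = (a + d) / 2 + r / 2"
    and lin_j: "x = (1 - t) / 2 * a + (1 + t) / 2 * d - X \<Longrightarrow> t * (a - d) + 2 * X = r \<Longrightarrow> x = (a + d) / 2 - r / 2"
    for x X :: real
    by (simp_all add: field_simps)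
  define T where "T = (\<chi> m k. if k = i then c * S $ m $ i + s * u * S $ m $ j
      else if k = j then - s * cnj u * S $ m $ i + c * S $ m $ j else S $ m $ k)"
  have Ti: "column i T = of_real c *s column i S + (s * u) *s column j S"
    and Tj: "column j T = (- s * cnj u) *s column i S + of_real c *s column j S"
    and Tk: "k \<noteq> i \<Longrightarrow> k \<noteq> j \<Longrightarrow> column k T = column k S" for k
    using ij by (auto simp: T_def column_def vec_eq_iff)
  have cols: "cdot (column k S) (column l S) = (if k = l then 1 else 0)" for k l
    using S by (simp add: unitary_matrix_iff_columns)
  have cs1': "complex_of_real c * c + complex_of_real s * s = 1"
    using cs1 by (metis of_real_1 of_real_add of_real_mult power2_eq_square)
  have uni: "unitary_matrix T"
    unfolding unitary_matrix_iff_columns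
  proof (intro allI)
    fix k l
    have ii: "cdot (column i T) (column i T) = 1"
    proof -
      have "cdot (column i T) (column i T) = complex_of_real c * c + (complex_of_real s * s) * (u * cnj u)"
        using ij unfolding Ti cdot_simps cols by (simp add: algebra_simps)
      then show ?thesis by (simp add: uu cs1')
    qed
    have jj: "cdot (column j T) (column j T) = 1"
    proof -
      have "cdot (column j T) (column j T) = complex_of_real c * c + (complex_of_real s * s) * (u * cnj u)"
        using ij unfolding Tj cdot_simps cols by (simp add: algebra_simps)
      then show ?thesis by (simp add: uu cs1')
    qed
    have ijT: "cdot (column i T) (column j T) = 0"
      using ij unfolding Ti Tj cdot_simps cols by simp
    have jiT: "cdot (column j T) (column i T) = 0"
      using ijT cdot_commute[of "column j T" "column i T"] by simp
    have ik: "cdot (column i T) (column m T) = 0" "cdot (column m T) (column i T) = 0"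
      "cdot (column j T) (column m T) = 0" "cdot (column m T) (column j T) = 0"
      if "m \<noteq> i" "m \<noteq> j" for m
      using that ij unfolding Ti Tj Tk[OF that] cdot_simps cols by simp_all
    show "cdot (column k T) (column l T) = (if k = l then 1 else 0)"
      using ii jj ijT jiT ik Tk cols ij by (cases "k = i"; cases "k = j"; cases "l = i"; cases "l = j") auto
  qed
  have Dij: "D S i j = b" and Dji: "D S j i = cnj b" using herm[of S i j] by (auto simp: b_def)
  have ub': "cnj u * cnj b = cmod b" using ub by (metis complex_cnj_complex_of_real complex_cnj_mult)
  have Dlin: "cdot (x *s v + y *s w) (A *v (x' *s v' + y' *s w')) =
      cnj x * x' * cdot v (A *v v') + cnj x * y' * cdot v (A *v w')
      + cnj y * x' * cdot w (A *v v') + cnj y * y' * cdot w (A *v w')" for x y v w x' y' v' w'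
    by (simp add: vec.add vec.scale cdot_simps algebra_simps)
  have "D T i i = c * c * a + s * s * (u * cnj u) * d + c * s * (u * b) + c * s * (cnj u * cnj b)"
    unfolding D_def Ti Dlin unfolding D_def[symmetric] Dij Dji aa dd by (simp add: algebra_simps)
  then have "D T i i = of_real (c\<^sup>2 * a + s\<^sup>2 * d + 2 * (c * s) * cmod b)"
    by (simp add: uu ub ub' power2_eq_square)
  then have "Re (D T i i) = Re (complex_of_real (c\<^sup>2 * a + s\<^sup>2 * d + 2 * (c * s) * cmod b))"
    by (rule arg_cong)
  then have i': "Re (D T i i) = (a + d) / 2 + r / 2"
    unfolding cs c2 s2 Re_complex_of_real by (rule lin_i[OF _ key])
  have "D T j j = s * s * (u * cnj u) * a + c * c * d - c * s * (u * b) - c * s * (cnj u * cnj b)"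
    unfolding D_def Tj Dlin unfolding D_def[symmetric] Dij Dji aa dd by (simp add: algebra_simps)
  then have "D T j j = of_real (s\<^sup>2 * a + c\<^sup>2 * d - 2 * (c * s) * cmod b)"
    by (simp add: uu ub ub' power2_eq_square)
  then have "Re (D T j j) = Re (complex_of_real (s\<^sup>2 * a + c\<^sup>2 * d - 2 * (c * s) * cmod b))"
    by (rule arg_cong)
  then have j': "Re (D T j j) = (a + d) / 2 - r / 2"
    unfolding cs c2 s2 Re_complex_of_real by (rule lin_j[OF _ key])
  \<comment> \<open>The rotated block is diagonal, so its two squared diagonal entries carry the
    whole Frobenius norm of the old block, including the contribution \<open>2 * (cmod b)^2\<close>
    of the annihilated entries.\<close>
  have "(Re (D T i i))\<^sup>2 + (Re (D T j j))\<^sup>2 = ((a + d)\<^sup>2 + r\<^sup>2) / 2"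
    unfolding i' j' by (simp add: power2_eq_square field_simps)
  also have "\<dots> = a\<^sup>2 + d\<^sup>2 + 2 * (cmod b)\<^sup>2"
    unfolding r2 by (simp add: power2_eq_square field_simps)
  finally have gt: "(Re (D T i i))\<^sup>2 + (Re (D T j j))\<^sup>2 > (Re (D S i i))\<^sup>2 + (Re (D S j j))\<^sup>2"
    using b by (simp add: a_def d_def)
  have split: "(\<Sum>k\<in>UNIV. f k) = f i + f j + (\<Sum>k\<in>UNIV - {i, j}. f k)" for f :: "'n \<Rightarrow> real"
    using ij by (simp add: sum.subset_diff[of "{i, j}" UNIV] add.commute)
  have "(\<Sum>k\<in>UNIV - {i, j}. (Re (D T k k))\<^sup>2) = (\<Sum>k\<in>UNIV - {i, j}. (Re (D S k k))\<^sup>2)"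
    by (intro sum.cong) (auto simp: D_def Tk)
  then have "(\<Sum>k\<in>UNIV. (Re (D S k k))\<^sup>2) < (\<Sum>k\<in>UNIV. (Re (D T k k))\<^sup>2)"
    unfolding split using gt by linarith
  then show ?thesis using uni unfolding D by blast
qed

lemma unitary_diagonalization:
  fixes A :: "complex ^ 'n ^ 'n"
  assumes A: "self_adjoint A"
  obtains S \<mu> where "unitary_matrix S" "A = S ** real_diag \<mu> ** cadjoint S"
proof -
  let ?\<Phi> = "\<lambda>S. \<Sum>k\<in>UNIV. (Re ((cadjoint S ** A ** S) $ k $ k))\<^sup>2"
  have "unitary_matrix (mat 1 :: complex ^ 'n ^ 'n)"
  proof -
    have "cadjoint (mat 1) = (mat 1 :: complex ^ 'n ^ 'n)"
      by (simp add: cadjoint_def mat_def vec_eq_iff)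
    then show ?thesis by (simp add: unitary_matrix_def)
  qed
  moreover have "continuous_on {S. unitary_matrix S} ?\<Phi>"
    by (intro continuous_intros)
  ultimately obtain S where S: "unitary_matrix S"
    and max: "\<And>T. unitary_matrix T \<Longrightarrow> ?\<Phi> T \<le> ?\<Phi> S"
    using continuous_attains_sup[OF compact_unitary_matrices, of ?\<Phi>] by blast
  define D where "D = cadjoint S ** A ** S"
  have off: "D $ i $ j = 0" if "i \<noteq> j" for i j
    using jacobi_rotation[OF A S that] max unfolding D_def by (meson not_le)
  have "cadjoint D = D"
    using A by (simp add: D_def cadjoint_mult self_adjoint_def matrix_mul_assoc)
  then have "cnj (D $ i $ i) = D $ i $ i" for i
    by (simp add: cadjoint_def vec_eq_iff)
  then have "D = real_diag (\<lambda>i. Re (D $ i $ i))"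
    using off by (auto simp: real_diag_def vec_eq_iff complex_eq_iff)
  then obtain \<mu> where "D = real_diag \<mu>" by blast
  moreover have "S ** D ** cadjoint S = A"
  proof -
    have "S ** D ** cadjoint S = (S ** cadjoint S) ** A ** (S ** cadjoint S)"
      by (simp add: D_def matrix_mul_assoc)
    then show ?thesis using S by (simp add: unitary_matrix_def)
  qed
  ultimately show ?thesis using that[of S \<mu>] S by simp
qed

lemma real_diag_mult_left: "(real_diag \<mu> ** A) $ i $ j = of_real (\<mu> i) * A $ i $ j"
  by (simp add: real_diag_def matrix_matrix_mult_def if_distrib if_distribR cong: if_cong)

lemma real_diag_mult_right: "(A ** real_diag \<mu>) $ i $ j = A $ i $ j * of_real (\<mu> j)"
  by (simp add: real_diag_def matrix_matrix_mult_def if_distrib if_distribR cong: if_cong)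

lemma real_diag_mult: "real_diag \<mu> ** real_diag \<nu> = real_diag (\<lambda>i. \<mu> i * \<nu> i)"
  by (simp add: vec_eq_iff real_diag_mult_left) (simp add: real_diag_def)

lemma real_diag_mult_vec: "(real_diag \<mu> *v v) $ i = of_real (\<mu> i) * v $ i"
  by (simp add: real_diag_def matrix_vector_mult_def if_distrib if_distribR cong: if_cong)

lemma unitary_cancel:
  assumes "unitary_matrix S"
  shows "cadjoint S ** (S ** A) = A" "S ** (cadjoint S ** A) = A"
    "A ** S ** cadjoint S = A" "A ** cadjoint S ** S = A"
  using assms unfolding unitary_matrix_def by (metis matrix_mul_assoc matrix_mul_lid matrix_mul_rid)+

text \<open>If \<open>diag(\<mu>') P = P diag(\<mu>)\<close>, then \<open>P\<^sub>i\<^sub>j \<noteq> 0\<close> forces \<open>\<mu>'\<^sub>i = \<mu>\<^sub>j\<close>, so \<open>g\<close> may be applied on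
  both sides; this makes the spectral calculus independent of the diagonalisation.\<close>

lemma spectral_fun_eq:
  assumes S: "unitary_matrix S" and A: "A = S ** real_diag \<mu> ** cadjoint S"
  shows "spectral_fun g A = S ** real_diag (\<lambda>i. g (\<mu> i)) ** cadjoint S"
  unfolding spectral_fun_def
proof (rule the_equality)
  show "\<exists>S' \<mu>'. unitary_matrix S' \<and> A = S' ** real_diag \<mu>' ** cadjoint S' \<and>
      S ** real_diag (\<lambda>i. g (\<mu> i)) ** cadjoint S = S' ** real_diag (\<lambda>i. g (\<mu>' i)) ** cadjoint S'"
    using assms by blast
next
  fix B assume "\<exists>S' \<mu>'. unitary_matrix S' \<and> A = S' ** real_diag \<mu>' ** cadjoint S' \<and>
      B = S' ** real_diag (\<lambda>i. g (\<mu>' i)) ** cadjoint S'"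
  then obtain S' \<mu>' where S': "unitary_matrix S'" and A': "A = S' ** real_diag \<mu>' ** cadjoint S'"
    and B: "B = S' ** real_diag (\<lambda>i. g (\<mu>' i)) ** cadjoint S'" by blast
  define P where "P = cadjoint S' ** S"
  have "real_diag \<mu>' ** P = cadjoint S' ** (S' ** real_diag \<mu>' ** cadjoint S') ** S"
    using S' by (simp add: P_def matrix_mul_assoc unitary_matrix_def)
  also have "\<dots> = cadjoint S' ** (S ** real_diag \<mu> ** cadjoint S) ** S"
    using A A' by simp
  also have "\<dots> = P ** real_diag \<mu>"
    using S by (simp add: P_def matrix_mul_assoc unitary_cancel)
  finally have "of_real (\<mu>' i) * P $ i $ j = P $ i $ j * of_real (\<mu> j)" for i j
    by (metis real_diag_mult_left real_diag_mult_right)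
  then have "\<mu>' i = \<mu> j \<or> P $ i $ j = 0" for i j
    by (metis mult.commute mult_cancel_left of_real_eq_iff)
  then have "of_real (g (\<mu>' i)) * P $ i $ j = P $ i $ j * of_real (g (\<mu> j))" for i j
    by (metis mult.commute mult_zero_left)
  then have gP: "real_diag (\<lambda>i. g (\<mu>' i)) ** P = P ** real_diag (\<lambda>i. g (\<mu> i))"
    by (simp add: vec_eq_iff real_diag_mult_left real_diag_mult_right)
  have "B = S' ** (real_diag (\<lambda>i. g (\<mu>' i)) ** P) ** cadjoint S"
    using S by (simp add: B P_def matrix_mul_assoc unitary_cancel)
  also have "\<dots> = S ** real_diag (\<lambda>i. g (\<mu> i)) ** cadjoint S"
    unfolding gP using S' by (simp add: P_def matrix_mul_assoc[symmetric] unitary_cancel)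
  finally show "B = S ** real_diag (\<lambda>i. g (\<mu> i)) ** cadjoint S" .
qed

text \<open>Each eigenvalue is the quadratic form of \<open>A\<close> at the corresponding column of
  \<open>S\<close>, and a column of a unitary matrix is nonzero.\<close>

lemma pos_definite_diagonalization:
  assumes A: "pos_definite A"
  obtains S \<mu> where "unitary_matrix S" "A = S ** real_diag \<mu> ** cadjoint S" "\<And>i. 0 < \<mu> i"
proof -
  obtain S \<mu> where S: "unitary_matrix S" and eq: "A = S ** real_diag \<mu> ** cadjoint S"
    using unitary_diagonalization A by (metis pos_definite_def)
  have "0 < \<mu> i" for i
  proof -
    have "cdot (column i S) (column i S) = 1"
      using S by (simp add: unitary_matrix_iff_columns)
    then have "column i S \<noteq> 0" by (auto simp: cdot_def)
    then have "0 < Re (cdot (column i S) (A *v column i S))"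
      using A by (auto simp: pos_definite_def cdot_def)
    also have "cdot (column i S) (A *v column i S) = (cadjoint S ** A ** S) $ i $ i"
      by (simp add: conjugate_entry)
    also have "cadjoint S ** A ** S = real_diag \<mu>"
      using S by (simp add: eq matrix_mul_assoc[symmetric] unitary_cancel) (simp add: unitary_matrix_def)
    finally show ?thesis by (simp add: real_diag_def)
  qed
  then show ?thesis using that S eq by blast
qed

lemma mpowr_eq:
  assumes "unitary_matrix S" "A = S ** real_diag \<mu> ** cadjoint S"
  shows "mpowr A a = S ** real_diag (\<lambda>i. \<mu> i powr a) ** cadjoint S"
  unfolding mpowr_def using assms by (rule spectral_fun_eq)

text \<open>Needed to rewrite the power \<open>1 / p\<close> of \<open>V\<close> to the
  \<open>p / q\<close>, as it occurs in the norm of the source space, as the power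
  \<open>1 / q\<close> of \<open>V\<close>.\<close>

lemma mpowr_mpowr:
  assumes "pos_definite A"
  shows "mpowr (mpowr A a) b = mpowr A (a * b)"
proof -
  obtain S \<mu> where S: "unitary_matrix S" "A = S ** real_diag \<mu> ** cadjoint S"
    using pos_definite_diagonalization assms by blast
  show ?thesis
    by (simp add: mpowr_eq[OF S] mpowr_eq[OF S(1) refl] powr_powr)
qed

lemma mpowr_minus_mult:
  assumes "pos_definite A"
  shows "mpowr A (- a) ** mpowr A a = mat 1"
proof -
  obtain S \<mu> where S: "unitary_matrix S" "A = S ** real_diag \<mu> ** cadjoint S" and \<mu>: "\<And>i. 0 < \<mu> i"
    using pos_definite_diagonalization assms by blast
  have "mpowr A (- a) ** mpowr A a =
      S ** (real_diag (\<lambda>i. \<mu> i powr (- a)) ** real_diag (\<lambda>i. \<mu> i powr a)) ** cadjoint S"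
    using S(1) by (simp add: mpowr_eq[OF S] matrix_mul_assoc unitary_cancel)
  \<comment> \<open>Positivity of the eigenvalues matters here: \<open>0 powr a = 0\<close>, so a
    zero eigenvalue would contribute \<open>0\<close> instead of \<open>1\<close> to the
    product.\<close>
  also have "real_diag (\<lambda>i. \<mu> i powr (- a)) ** real_diag (\<lambda>i. \<mu> i powr a) = (mat 1 :: complex ^ 'a ^ 'a)"
    using \<mu> by (simp add: real_diag_mult powr_add[symmetric] less_imp_neq[symmetric])
      (simp add: real_diag_def mat_def cong: if_cong)
  finally show ?thesis using S(1) by (simp add: unitary_matrix_def)
qed

section \<open>Unitary invariance and operator norm estimates\<close>

lemma unitary_norm:
  assumes "unitary_matrix S"
  shows "norm (S *v v) = norm v"
proof -
  have "cdot (S *v v) (S *v v) = cdot v v"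
    using assms by (simp add: cdot_matrix_vector matrix_vector_mul_assoc unitary_matrix_def)
  then have "(norm (S *v v))\<^sup>2 = (norm v)\<^sup>2"
    unfolding cdot_self of_real_eq_iff .
  then show ?thesis by simp
qed

lemma unitary_cadjoint: "unitary_matrix S \<Longrightarrow> unitary_matrix (cadjoint S)"
  by (simp add: unitary_matrix_def)

lemma norm_matrix_vector_le: "norm (A *v v) \<le> matrix_opnorm A * norm v"
  unfolding matrix_opnorm_def by (rule onorm) simp

lemma matrix_opnorm_nonneg: "0 \<le> matrix_opnorm A"
  unfolding matrix_opnorm_def by (rule onorm_pos_le) simp

lemma matrix_opnorm_mult: "matrix_opnorm (A ** B) \<le> matrix_opnorm A * matrix_opnorm B"
  using onorm_compose[of "(*v) A" "(*v) B"]
  by (simp add: matrix_opnorm_def comp_def matrix_vector_mul_assoc)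

lemma matrix_opnorm_triangle: "matrix_opnorm (A + B) \<le> matrix_opnorm A + matrix_opnorm B"
  using onorm_triangle[of "(*v) A" "(*v) B"]
  by (simp add: matrix_opnorm_def matrix_vector_mult_add_rdistrib)

lemma matrix_opnorm_minus: "matrix_opnorm (- A) = matrix_opnorm A"
proof -
  have "(- A) *v v = - (A *v v)" for v
    by (simp add: matrix_vector_mult_def vec_eq_iff sum_negf)
  then show ?thesis using onorm_neg[of "(*v) A"] by (simp add: matrix_opnorm_def)
qed

lemma matrix_vector_axis: "A *v axis j 1 = column j (A :: complex ^ 'n ^ 'm)"
  by (simp add: matrix_vector_mult_def axis_def column_def vec_eq_iff if_distrib cong: if_cong)

text \<open>The column bound is meant for \<open>X B\<close>, whose columns are controlled by the
  choice of \<open>B\<close>; the row bound below is meant for \<open>T Y\<close>, since duality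
  gives information about rows.\<close>

lemma matrix_opnorm_le_columns: "matrix_opnorm A \<le> (\<Sum>j\<in>UNIV. norm (A *v axis j 1))"
  unfolding matrix_opnorm_def
proof (rule onorm_le)
  fix v
  have "A *v v = (\<Sum>j\<in>UNIV. v $ j *s (A *v axis j 1))"
    unfolding matrix_vector_axis by (rule matrix_mult_sum)
  also have "norm \<dots> \<le> (\<Sum>j\<in>UNIV. norm (v $ j *s (A *v axis j 1)))"
    by (rule norm_sum)
  also have "\<dots> \<le> (\<Sum>j\<in>UNIV. norm (A *v axis j 1) * norm v)"
  proof (rule sum_mono)
    fix j
    have "norm (v $ j *s (A *v axis j 1)) = cmod (v $ j) * norm (A *v axis j 1)"
      by (simp add: norm_vec_def norm_mult L2_set_right_distrib)
    then show "norm (v $ j *s (A *v axis j 1)) \<le> norm (A *v axis j 1) * norm v"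
      by (simp add: mult.commute[of _ "norm v"] mult_right_mono Finite_Cartesian_Product.norm_nth_le)
  qed
  finally show "norm (A *v v) \<le> (\<Sum>j\<in>UNIV. norm (A *v axis j 1)) * norm v"
    by (simp add: sum_distrib_right)
qed

lemma matrix_opnorm_le_rows: "matrix_opnorm A \<le> (\<Sum>i\<in>UNIV. norm (A $ i))"
  unfolding matrix_opnorm_def
proof (rule onorm_le)
  fix v
  have *: "cmod ((A *v v) $ i) \<le> norm (A $ i) * norm v" for i
  proof -
    have "cmod ((A *v v) $ i) \<le> (\<Sum>j\<in>UNIV. \<bar>cmod (A $ i $ j)\<bar> * \<bar>cmod (v $ j)\<bar>)"
      unfolding matrix_vector_mult_def by (simp add: sum_norm_le norm_mult)
    also have "\<dots> \<le> norm (A $ i) * norm v"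
      unfolding norm_vec_def by (rule L2_set_mult_ineq)
    finally show ?thesis .
  qed
  have "norm (A *v v) \<le> (\<Sum>i\<in>UNIV. cmod ((A *v v) $ i))" by (rule norm_vec_le_sum)
  also have "\<dots> \<le> (\<Sum>i\<in>UNIV. norm (A $ i)) * norm v"
    unfolding sum_distrib_right by (intro sum_mono *)
  finally show "norm (A *v v) \<le> (\<Sum>i\<in>UNIV. norm (A $ i)) * norm v" .
qed

lemma matrix_opnorm_le_entries: "matrix_opnorm A \<le> (\<Sum>i\<in>UNIV. \<Sum>j\<in>UNIV. cmod (A $ i $ j))"
  by (rule order_trans[OF matrix_opnorm_le_rows]) (intro sum_mono norm_vec_le_sum)

text \<open>By the triangle inequality in both directions the norms of \<open>A\<close> and
  \<open>B\<close> differ by at most that of \<open>B - A\<close>, which is at most the sum of the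
  moduli of its entries.\<close>

lemma continuous_on_matrix_opnorm: "continuous_on T matrix_opnorm"
proof -
  have "((\<lambda>B. matrix_opnorm B) \<longlongrightarrow> matrix_opnorm A) (at A)" for A :: "complex ^ 'n ^ 'n"
  proof (rule LIM_zero_cancel, rule Lim_null_comparison)
    show "eventually (\<lambda>B. norm (matrix_opnorm B - matrix_opnorm A)
        \<le> (\<Sum>i\<in>UNIV. \<Sum>j\<in>UNIV. cmod ((B - A) $ i $ j))) (at A)"
    proof (intro always_eventually allI)
      fix B
      have "matrix_opnorm B \<le> matrix_opnorm A + matrix_opnorm (B - A)"
        using matrix_opnorm_triangle[of A "B - A"] by simp
      moreover have "matrix_opnorm A \<le> matrix_opnorm B + matrix_opnorm (B - A)"
        using matrix_opnorm_triangle[of B "A - B"] matrix_opnorm_minus[of "B - A"] by simp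
      ultimately show "norm (matrix_opnorm B - matrix_opnorm A)
        \<le> (\<Sum>i\<in>UNIV. \<Sum>j\<in>UNIV. cmod ((B - A) $ i $ j))"
        using matrix_opnorm_le_entries[of "B - A"] by (simp add: abs_le_iff)
    qed
    have "((\<lambda>B. \<Sum>i\<in>UNIV. \<Sum>j\<in>UNIV. cmod ((B - A) $ i $ j)) \<longlongrightarrow>
        (\<Sum>i\<in>(UNIV::'n set). \<Sum>j\<in>(UNIV::'n set). cmod ((A - A) $ i $ j))) (at A)"
      by (intro tendsto_intros)
    then show "((\<lambda>B. \<Sum>i\<in>UNIV. \<Sum>j\<in>UNIV. cmod ((B - A) $ i $ j)) \<longlongrightarrow> 0) (at A)"
      by simp
  qed
  then show ?thesis by (intro continuous_at_imp_continuous_on ballI) (simp add: isCont_def)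
qed

lemma norm_axis_eq: "norm (axis i x) = norm x"
  by (simp add: norm_vec_def L2_set_def axis_def if_distrib[of norm] if_distrib[of "\<lambda>t. t\<^sup>2"] cong: if_cong)

text \<open>Every eigenvalue is at most the operator norm of \<open>A\<close>, as one sees on the
  unit eigenvector \<open>S *v axis i 1\<close>; hence \<open>A\<close> to the power
  \<open>1 / q\<close> expands lengths by at most the \<open>q\<close>-th root of that norm. This is
  what makes \<open>norm (X v) powr q\<close> integrable on cubes.\<close>

lemma norm_mpowr_vec_le:
  assumes A: "pos_definite A" and q: "0 < q"
  shows "norm (mpowr A (1 / q) *v v) powr q \<le> matrix_opnorm A * norm v powr q"
proof -
  obtain S \<mu> where S: "unitary_matrix S" "A = S ** real_diag \<mu> ** cadjoint S" and \<mu>: "\<And>i. 0 < \<mu> i"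
    using pos_definite_diagonalization A by blast
  have le: "\<mu> i \<le> matrix_opnorm A" for i
  proof -
    have "A ** S = S ** real_diag \<mu>"
      using S(1) by (simp add: S(2) unitary_cancel)
    then have "A *v (S *v axis i 1) = S *v (real_diag \<mu> *v axis i 1)"
      by (simp add: matrix_vector_mul_assoc)
    moreover have "real_diag \<mu> *v axis i 1 = axis i (of_real (\<mu> i))"
      by (simp add: vec_eq_iff real_diag_mult_vec axis_def)
    ultimately have "norm (A *v (S *v axis i 1)) = \<mu> i"
      using \<mu>[of i] by (simp add: unitary_norm[OF S(1)] norm_axis_eq)
    moreover have "norm (A *v (S *v axis i 1)) \<le> matrix_opnorm A * norm (S *v axis i 1)"
      by (rule norm_matrix_vector_le)
    ultimately show ?thesis by (simp add: unitary_norm[OF S(1)])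
  qed
  define m where "m = matrix_opnorm A powr (1 / q)"
  define w where "w = cadjoint S *v v"
  have nw: "norm w = norm v" unfolding w_def by (rule unitary_norm[OF unitary_cadjoint[OF S(1)]])
  have "norm (mpowr A (1 / q) *v v) = norm (real_diag (\<lambda>i. \<mu> i powr (1 / q)) *v w)"
    by (simp add: mpowr_eq[OF S] w_def matrix_vector_mul_assoc[symmetric] unitary_norm[OF S(1)])
  also have "\<dots> \<le> L2_set (\<lambda>i. m * cmod (w $ i)) UNIV"
    unfolding norm_vec_def real_diag_mult_vec
    using \<mu>[THEN less_imp_le] le q
    by (intro L2_set_mono) (auto simp: norm_mult m_def intro!: mult_right_mono powr_mono2)
  also have "\<dots> = m * norm w"
    by (simp add: L2_set_right_distrib m_def norm_vec_def)
  finally have "norm (mpowr A (1 / q) *v v) powr q \<le> (m * norm v) powr q"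
    unfolding nw using q by (intro powr_mono2) auto
  also have "\<dots> = matrix_opnorm A * norm v powr q"
    using q matrix_opnorm_nonneg[of A] by (simp add: powr_mult m_def powr_powr)
  finally show ?thesis .
qed

section \<open>Continuity and measurability of matrix powers\<close>

lemma tendsto_matrix_mult [tendsto_intros]:
  fixes f :: "'x \<Rightarrow> complex ^ 'n ^ 'm" and g :: "'x \<Rightarrow> complex ^ 'k ^ 'n"
  assumes "(f \<longlongrightarrow> A) F" "(g \<longlongrightarrow> B) F"
  shows "((\<lambda>x. f x ** g x) \<longlongrightarrow> A ** B) F"
  unfolding matrix_matrix_mult_def by (intro tendsto_intros assms)

lemma tendsto_cadjoint [tendsto_intros]:
  assumes "(f \<longlongrightarrow> A) F"
  shows "((\<lambda>x. cadjoint (f x)) \<longlongrightarrow> cadjoint A) F"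
  unfolding cadjoint_def by (intro tendsto_intros assms)

lemma tendsto_real_diag:
  assumes "\<And>i. ((\<lambda>x. f x i) \<longlongrightarrow> \<mu> i) F"
  shows "((\<lambda>x. real_diag (f x)) \<longlongrightarrow> real_diag \<mu>) F"
  unfolding real_diag_def
proof (intro tendsto_vec_lambda)
  fix i j
  show "((\<lambda>x. if i = j then complex_of_real (f x i) else 0) \<longlongrightarrow> (if i = j then complex_of_real (\<mu> i) else 0)) F"
    by (cases "i = j") (auto intro!: tendsto_intros assms)
qed

text \<open>Eigenvectors need not depend continuously on the matrix, so the diagonalising unitaries
  of \<open>X k\<close> need not converge. By compactness a subsequence does, and its limit
  diagonalises \<open>A\<close>.\<close>

lemma mpowr_subseq_limit:
  fixes X :: "nat \<Rightarrow> complex ^ 'n ^ 'n"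
  assumes X: "X \<longlonglongrightarrow> A" and pX: "\<And>k. pos_definite (X k)" and pA: "pos_definite A"
  shows "\<exists>r. strict_mono r \<and> (\<lambda>k. mpowr (X (r k)) a) \<longlonglongrightarrow> mpowr A a"
proof -
  have "\<exists>S \<mu>. unitary_matrix S \<and> X k = S ** real_diag \<mu> ** cadjoint S" for k
    using pX[of k] unitary_diagonalization by (metis pos_definite_def)
  then obtain S \<mu> where S: "\<And>k. unitary_matrix (S k)"
    and eq: "\<And>k. X k = S k ** real_diag (\<mu> k) ** cadjoint (S k)" by metis
  have "\<forall>k. S k \<in> {S. unitary_matrix S}" using S by simp
  then obtain T r where T: "unitary_matrix T" and r: "strict_mono r" and lim: "(S \<circ> r) \<longlonglongrightarrow> T"
    using seq_compactE[OF compact_unitary_matrices[unfolded compact_eq_seq_compact_metric]]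
    by (metis mem_Collect_eq)
  have limS: "(\<lambda>k. S (r k)) \<longlonglongrightarrow> T" using lim by (simp add: comp_def)
  have limX: "(\<lambda>k. X (r k)) \<longlonglongrightarrow> A" using LIMSEQ_subseq_LIMSEQ[OF X r] by (simp add: comp_def)
  define D where "D = cadjoint T ** A ** T"
  have SXS: "cadjoint (S k) ** X k ** S k = real_diag (\<mu> k)" for k
    using S by (simp add: eq matrix_mul_assoc[symmetric] unitary_cancel) (simp add: unitary_matrix_def)
  have "(\<lambda>k. cadjoint (S (r k)) ** X (r k) ** S (r k)) \<longlonglongrightarrow> D"
    unfolding D_def by (intro tendsto_intros limS limX)
  then have limD: "(\<lambda>k. real_diag (\<mu> (r k))) \<longlonglongrightarrow> D" by (simp add: SXS)
  define \<nu> where "\<nu> i = Re (D $ i $ i)" for i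
  \<comment> \<open>No separate compactness argument is needed for the eigenvalues: they are the
    diagonal entries of the conjugated matrices, which converge once \<open>S (r k)\<close>
    does.\<close>
  have lim\<mu>: "(\<lambda>k. \<mu> (r k) i) \<longlonglongrightarrow> \<nu> i" for i
  proof -
    have "(\<lambda>k. Re (real_diag (\<mu> (r k)) $ i $ i)) \<longlonglongrightarrow> \<nu> i"
      unfolding \<nu>_def by (intro tendsto_intros limD)
    then show ?thesis by (simp add: real_diag_def)
  qed
  have "T ** D ** cadjoint T = A"
    using T by (simp add: D_def matrix_mul_assoc unitary_cancel) (simp add: unitary_matrix_def)
  then have A: "A = T ** real_diag \<nu> ** cadjoint T"
    using LIMSEQ_unique[OF limD tendsto_real_diag[OF lim\<mu>]] by simp
  \<comment> \<open>Positivity of the limiting eigenvalues makes \<open>powr a\<close> continuous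
    there, also for negative \<open>a\<close>.\<close>
  have \<nu>: "0 < \<nu> i" for i
  proof -
    have "cdot (column i T) (column i T) = 1"
      using T by (simp add: unitary_matrix_iff_columns)
    then have "column i T \<noteq> 0" by (auto simp: cdot_def)
    then show ?thesis
      using pA by (auto simp: \<nu>_def D_def conjugate_entry pos_definite_def cdot_def)
  qed
  have "(\<lambda>k. S (r k) ** real_diag (\<lambda>i. \<mu> (r k) i powr a) ** cadjoint (S (r k)))
      \<longlonglongrightarrow> T ** real_diag (\<lambda>i. \<nu> i powr a) ** cadjoint T"
    by (intro tendsto_intros tendsto_real_diag limS lim\<mu>) (use \<nu> in \<open>simp add: less_imp_neq[symmetric]\<close>)
  then have "(\<lambda>k. mpowr (X (r k)) a) \<longlonglongrightarrow> mpowr A a"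
    by (simp add: mpowr_eq[OF T A] mpowr_eq[OF S eq])
  then show ?thesis using r by blast
qed

text \<open>Subsequence principle: otherwise some subsequence stays at distance at least
  \<open>e\<close> from the limit, yet by \<open>mpowr_subseq_limit\<close> it has a further
  subsequence that converges to it.\<close>

lemma continuous_on_mpowr: "continuous_on {A. pos_definite A} (\<lambda>A. mpowr A a)"
  unfolding continuous_on_sequentially
proof (intro allI ballI impI, elim conjE)
  fix X :: "nat \<Rightarrow> complex ^ 'n ^ 'n" and A
  assume X: "\<forall>n. X n \<in> {A. pos_definite A}" "X \<longlonglongrightarrow> A" and A: "A \<in> {A. pos_definite A}"
  show "((\<lambda>A. mpowr A a) \<circ> X) \<longlonglongrightarrow> mpowr A a"
  proof (rule ccontr)
    assume "\<not> ?thesis"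
    then obtain e where e: "e > 0" "\<not> eventually (\<lambda>k. dist (mpowr (X k) a) (mpowr A a) < e) sequentially"
      by (auto simp: tendsto_iff comp_def)
    obtain r :: "nat \<Rightarrow> nat" where r: "strict_mono r" "\<And>k. \<not> dist (mpowr (X (r k)) a) (mpowr A a) < e"
      using not_eventually_sequentiallyD[OF e(2)] by (elim exE conjE) auto
    have "(\<lambda>k. X (r k)) \<longlonglongrightarrow> A" using LIMSEQ_subseq_LIMSEQ[OF X(2) r(1)] by (simp add: comp_def)
    then obtain r' where "(\<lambda>k. mpowr (X (r (r' k))) a) \<longlonglongrightarrow> mpowr A a"
      using mpowr_subseq_limit[of "\<lambda>k. X (r k)" A a] X A by auto
    then have "eventually (\<lambda>k. dist (mpowr (X (r (r' k))) a) (mpowr A a) < e) sequentially"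
      using e(1) by (simp add: tendsto_iff)
    then show False using r(2) by (simp add: eventually_sequentially)
  qed
qed

lemma continuous_on_axis:
  fixes f :: "'x::topological_space \<Rightarrow> 'a::real_normed_vector"
  assumes "continuous_on T f"
  shows "continuous_on T (\<lambda>x. axis i (f x) :: 'a ^ 'n)"
  unfolding axis_def
proof (rule continuous_on_vec_lambda)
  fix j show "continuous_on T (\<lambda>x. if j = i then f x else 0)"
    using assms by (cases "j = i") auto
qed

lemma borel_measurable_matrixI:
  fixes W :: "'x \<Rightarrow> complex ^ 'n ^ 'm"
  assumes "\<And>i j. (\<lambda>x. W x $ i $ j) \<in> borel_measurable M"
  shows "W \<in> borel_measurable M"
proof -
  have cont: "continuous_on UNIV (\<lambda>z::complex. axis i (axis j z) :: complex ^ 'n ^ 'm)" for i j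
    by (intro continuous_on_axis continuous_on_id)
  have axes: "v = (\<Sum>i\<in>UNIV. axis i (v $ i))" for v :: "'b::real_normed_vector ^ 'k"
    by (simp add: vec_eq_iff axis_def)
  have "W x = (\<Sum>i\<in>UNIV. \<Sum>j\<in>UNIV. axis i (axis j (W x $ i $ j)))" for x
  proof -
    have "axis i (\<Sum>j\<in>UNIV. f j) = (\<Sum>j\<in>UNIV. axis i (f j))" for i :: 'm and f :: "'n \<Rightarrow> complex ^ 'n"
      by (simp add: vec_eq_iff axis_def)
    then have "(\<Sum>i\<in>UNIV. \<Sum>j\<in>UNIV. axis i (axis j (W x $ i $ j)))
        = (\<Sum>i\<in>UNIV. axis i (\<Sum>j\<in>UNIV. axis j (W x $ i $ j)))" by simp
    also have "\<dots> = (\<Sum>i\<in>UNIV. axis i (W x $ i))" by (simp only: axes[symmetric])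
    also have "\<dots> = W x" by (rule axes[symmetric])
    finally show ?thesis by (rule sym)
  qed
  then have "W = (\<lambda>x. \<Sum>i\<in>UNIV. \<Sum>j\<in>UNIV. axis i (axis j (W x $ i $ j)))" by blast
  also have "\<dots> \<in> borel_measurable M"
    by (intro borel_measurable_sum borel_measurable_continuous_on[OF cont] assms)
  finally show ?thesis .
qed

text \<open>Integrability is given on compact sets, so each entry is measurable after truncation to
  a ball; letting the radius grow gives the entry itself as a pointwise limit.\<close>

lemma matrix_weight_measurable:
  assumes "matrix_weight W"
  shows "W \<in> borel_measurable lebesgue"
proof (rule borel_measurable_matrixI)
  fix i j
  have m: "(\<lambda>x. indicator (cball 0 (real k)) x *\<^sub>R W x $ i $ j) \<in> borel_measurable lebesgue" for k
    using assms unfolding matrix_weight_def set_integrable_def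
    by (intro borel_measurable_integrable) auto
  have "(\<lambda>k. indicator (cball 0 (real k)) x *\<^sub>R W x $ i $ j) \<longlonglongrightarrow> W x $ i $ j" for x
  proof (rule tendsto_eventually)
    obtain K where "norm x \<le> real K" using real_arch_simple by blast
    then have "indicator (cball 0 (real k)) x *\<^sub>R W x $ i $ j = W x $ i $ j" if "k \<ge> K" for k
      using that by (auto simp: indicator_def)
    then show "\<forall>\<^sub>F k in sequentially. indicator (cball 0 (real k)) x *\<^sub>R W x $ i $ j = W x $ i $ j"
      unfolding eventually_sequentially by blast
  qed
  then show "(\<lambda>x. W x $ i $ j) \<in> borel_measurable lebesgue"
    by (rule borel_measurable_LIMSEQ_metric[OF m])
qed

text \<open>Continuity is available on positive definite matrices, while \<open>W\<close> takes
  values there almost everywhere. Replacing \<open>W\<close> by the identity on the exceptional null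
  set allows composition, and the completed measure lets the result be carried back to
  \<open>W\<close>.\<close>

lemma mpowr_weight_measurable:
  fixes W :: "real ^ 'd \<Rightarrow> complex ^ 'n ^ 'n"
  assumes W: "matrix_weight W"
  shows "(\<lambda>x. mpowr (W x) a) \<in> borel_measurable lebesgue"
proof -
  have "AE x in lebesgue. pos_definite (W x)" using W by (simp add: matrix_weight_def)
  then obtain N where N: "N \<in> null_sets lebesgue" "\<And>x. x \<notin> N \<Longrightarrow> pos_definite (W x)"
    by (rule AE_E3) auto
  define W' where "W' x = (if x \<in> N then mat 1 else W x)" for x
  have "pos_definite (mat 1 :: complex ^ 'n ^ 'n)"
    unfolding pos_definite_def
  proof (intro conjI allI impI)
    show "self_adjoint (mat 1 :: complex ^ 'n ^ 'n)"
      by (simp add: self_adjoint_def cadjoint_def mat_def vec_eq_iff)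
    fix v :: "complex ^ 'n" assume "v \<noteq> 0"
    then show "0 < Re (\<Sum>i\<in>UNIV. cnj (v $ i) * (mat 1 *v v) $ i)"
      using cdot_self[of v] by (simp add: cdot_def)
  qed
  then have "W' x \<in> {A. pos_definite A}" for x using N by (simp add: W'_def)
  moreover have "W' \<in> borel_measurable lebesgue"
    unfolding W'_def using N(1) matrix_weight_measurable[OF W]
    by (intro measurable_If_set) (auto dest: null_setsD2)
  ultimately have "W' \<in> lebesgue \<rightarrow>\<^sub>M restrict_space borel {A. pos_definite A}"
    by (intro measurable_restrict_space2) auto
  from measurable_comp[OF this borel_measurable_continuous_on_restrict[OF continuous_on_mpowr]]
  have "(\<lambda>x. mpowr (W' x) a) \<in> borel_measurable lebesgue" by (simp add: comp_def)
  moreover have "AE x in lebesgue. mpowr (W' x) a = mpowr (W x) a"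
    using AE_not_in[OF N(1)] by eventually_elim (simp add: W'_def)
  ultimately show ?thesis by (rule borel_measurable_AE)
qed

subsection \<open>Real powers and Hoelder's inequality in the extended nonnegative reals\<close>

lemma epowr_ennreal: "0 \<le> r \<Longrightarrow> epowr (ennreal r) a = ennreal (r powr a)"
  by (simp add: epowr_def)

lemma epowr_top [simp]: "epowr top a = top"
  by (simp add: epowr_def)

lemma epowr_0 [simp]: "epowr 0 a = 0"
  by (simp add: epowr_def)

lemma epowr_1: "epowr x 1 = x"
  by (cases x) (simp_all add: epowr_ennreal)

lemma epowr_less_top: "x < top \<Longrightarrow> epowr x a < top"
  by (cases x) (simp_all add: epowr_ennreal)

lemma epowr_eq_0_iff: "epowr x a = 0 \<longleftrightarrow> x = 0"
  by (cases x) (simp_all add: epowr_ennreal)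

lemma epowr_mono:
  assumes "x \<le> y" "0 \<le> a"
  shows "epowr x a \<le> epowr y a"
  using assms by (cases x; cases y) (simp_all add: epowr_ennreal powr_mono2 top_unique)

text \<open>True for every exponent because \<open>epowr\<close> fixes both \<open>0\<close> and
  \<open>top\<close>, which agrees with the convention \<open>0 * top = 0\<close>.\<close>

lemma epowr_mult: "epowr (x * y) a = epowr x a * epowr y a"
proof (cases x; cases y)
  fix r s assume "x = ennreal r" "y = ennreal s" "0 \<le> r" "0 \<le> s"
  then show ?thesis by (simp add: epowr_ennreal ennreal_mult[symmetric] powr_mult)
qed (auto simp: epowr_ennreal ennreal_top_mult ennreal_mult_top epowr_eq_0_iff)

lemma epowr_epowr: "epowr (epowr x a) b = epowr x (a * b)"
  by (cases x) (simp_all add: epowr_ennreal powr_powr)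

lemma epowr_add: "epowr x (a + b) = epowr x a * epowr x b"
  by (cases x) (simp_all add: epowr_ennreal powr_add ennreal_mult)

lemma epowr_measurable [measurable]:
  assumes [measurable]: "f \<in> borel_measurable M"
  shows "(\<lambda>x. epowr (f x) a) \<in> borel_measurable M"
  unfolding epowr_def by measurable

text \<open>Young's inequality applied to \<open>F / \<alpha>\<close> and
  \<open>G / \<beta>\<close>, where \<alpha> and \<beta> are the two norms, and integrated. The
  division requires both norms positive and finite, whence the separate degenerate cases.\<close>

lemma nn_integral_Holder:
  assumes [measurable]: "F \<in> borel_measurable M" "G \<in> borel_measurable M"
    and p: "1 < p" "1 < p'" "1 / p' + 1 / p = 1"
  shows "(\<integral>\<^sup>+ x. F x * G x \<partial>M)
    \<le> epowr (\<integral>\<^sup>+ x. epowr (F x) p' \<partial>M) (1 / p') * epowr (\<integral>\<^sup>+ x. epowr (G x) p \<partial>M) (1 / p)"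
proof -
  define A where "A = (\<integral>\<^sup>+ x. epowr (F x) p' \<partial>M)"
  define B where "B = (\<integral>\<^sup>+ x. epowr (G x) p \<partial>M)"
  consider "A = 0" | "B = 0" | "A \<noteq> 0" "B \<noteq> 0" "A = top \<or> B = top"
    | a b where "A = ennreal a" "B = ennreal b" "0 < a" "0 < b"
    by (cases A; cases B) (auto simp: less_le)
  then have "(\<integral>\<^sup>+ x. F x * G x \<partial>M) \<le> epowr A (1 / p') * epowr B (1 / p)"
  proof cases
    case 1
    then have "AE x in M. F x = 0" unfolding A_def by (simp add: nn_integral_0_iff_AE epowr_eq_0_iff)
    then have "(\<integral>\<^sup>+ x. F x * G x \<partial>M) = (\<integral>\<^sup>+ x. 0 \<partial>M)"
      by (intro nn_integral_cong_AE) auto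
    then show ?thesis by simp
  next
    case 2
    then have "AE x in M. G x = 0" unfolding B_def by (simp add: nn_integral_0_iff_AE epowr_eq_0_iff)
    then have "(\<integral>\<^sup>+ x. F x * G x \<partial>M) = (\<integral>\<^sup>+ x. 0 \<partial>M)"
      by (intro nn_integral_cong_AE) auto
    then show ?thesis by simp
  next
    case 3
    then have "epowr A (1 / p') * epowr B (1 / p) = top"
      by (auto simp: ennreal_top_mult ennreal_mult_top epowr_eq_0_iff)
    then show ?thesis by simp
  next
    case 4
    define \<alpha> where "\<alpha> = a powr (1 / p')"
    define \<beta> where "\<beta> = b powr (1 / p)"
    have pos: "0 < \<alpha>" "0 < \<beta>" using 4 by (simp_all add: \<alpha>_def \<beta>_def)
    have pp: "\<alpha> powr p' = a" "\<beta> powr p = b"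
      using 4 p by (simp_all add: \<alpha>_def \<beta>_def powr_powr)
    have "F x * G x \<le> ennreal (\<alpha> * \<beta>) *
        (ennreal (1 / (p' * a)) * epowr (F x) p' + ennreal (1 / (p * b)) * epowr (G x) p)" for x
    proof (cases "F x"; cases "G x")
      fix f g assume fg: "F x = ennreal f" "G x = ennreal g" "0 \<le> f" "0 \<le> g"
      have "(f / \<alpha>) * (g / \<beta>) \<le> (f / \<alpha>) powr p' / p' + (g / \<beta>) powr p / p"
        using p pos fg by (intro Youngs_inequality) auto
      also have "\<dots> = f powr p' / (p' * a) + g powr p / (p * b)"
        using pos fg by (simp add: powr_divide pp mult.commute)
      finally have "f * g \<le> \<alpha> * \<beta> * (f powr p' / (p' * a) + g powr p / (p * b))"
        using pos by (simp add: divide_le_eq mult_ac)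
      then have "ennreal (f * g) \<le> ennreal (\<alpha> * \<beta> * (f powr p' / (p' * a) + g powr p / (p * b)))"
        by (rule ennreal_leI)
      then show ?thesis
        using p 4 pos fg
        by (simp add: epowr_ennreal ennreal_mult[symmetric] ennreal_plus[symmetric] del: ennreal_plus)
    qed (use p 4 pos in \<open>auto simp: ennreal_mult_top\<close>)
    then have "(\<integral>\<^sup>+ x. F x * G x \<partial>M) \<le> (\<integral>\<^sup>+ x. ennreal (\<alpha> * \<beta>) *
        (ennreal (1 / (p' * a)) * epowr (F x) p' + ennreal (1 / (p * b)) * epowr (G x) p) \<partial>M)"
      by (rule nn_integral_mono)
    also have "\<dots> = ennreal (\<alpha> * \<beta>) * (ennreal (1 / (p' * a)) * A + ennreal (1 / (p * b)) * B)"
      by (simp add: nn_integral_cmult nn_integral_add A_def B_def)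
    also have "\<dots> = ennreal (\<alpha> * \<beta> * (1 / (p' * a) * a + 1 / (p * b) * b))"
      using 4 p pos by (simp add: ennreal_mult[symmetric] ennreal_plus[symmetric] del: ennreal_plus)
    also have "1 / (p' * a) * a + 1 / (p * b) * b = 1" using 4 p by simp
    also have "ennreal (\<alpha> * \<beta> * 1) = epowr A (1 / p') * epowr B (1 / p)"
      using 4 by (simp add: \<alpha>_def \<beta>_def epowr_ennreal ennreal_mult)
    finally show ?thesis .
  qed
  then show ?thesis by (simp add: A_def B_def)
qed

text \<open>Jensen's inequality for the measure with density \<open>G\<close>, not normalised to
  mass one. For \<open>q > 1\<close> it is Hoelder's inequality for the factors
  \<open>epowr (G x) (1 / q')\<close> and \<open>F x * epowr (G x) (1 / q)\<close>.\<close>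

lemma nn_integral_weighted_power_le:
  assumes [measurable]: "F \<in> borel_measurable M" "G \<in> borel_measurable M" and q: "1 \<le> q"
  shows "epowr (\<integral>\<^sup>+ x. F x * G x \<partial>M) q
    \<le> (\<integral>\<^sup>+ x. epowr (F x) q * G x \<partial>M) * epowr (\<integral>\<^sup>+ x. G x \<partial>M) (q - 1)"
proof (cases "q = 1")
  case True
  \<comment> \<open>The last factor is now a zeroth power, and \<open>epowr 0 0 = 0\<close> instead
    of \<open>1\<close>. When the integral of \<open>G\<close> vanishes, so does the left-hand side;
    otherwise the factor is at least \<open>1\<close>.\<close>
  show ?thesis
  proof (cases "(\<integral>\<^sup>+ x. G x \<partial>M) = 0")
    case True
    then have "AE x in M. G x = 0" by (simp add: nn_integral_0_iff_AE)
    then have "(\<integral>\<^sup>+ x. F x * G x \<partial>M) = (\<integral>\<^sup>+ x. 0 \<partial>M)" by (intro nn_integral_cong_AE) auto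
    then show ?thesis by simp
  next
    case False
    have "1 \<le> epowr (\<integral>\<^sup>+ x. G x \<partial>M) 0"
      using False by (cases "\<integral>\<^sup>+ x. G x \<partial>M") (auto simp: epowr_ennreal)
    from mult_left_mono[OF this, of "\<integral>\<^sup>+ x. F x * G x \<partial>M"] show ?thesis
      using \<open>q = 1\<close> by (simp add: epowr_1)
  qed
next
  case False
  then have q: "1 < q" using q by simp
  define q' where "q' = q / (q - 1)"
  have q': "1 < q'" "1 / q' = 1 - 1 / q" using q by (simp_all add: q'_def field_simps)
  have "F x * G x = epowr (G x) (1 / q') * (F x * epowr (G x) (1 / q))" for x
  proof -
    have "epowr (G x) (1 / q') * epowr (G x) (1 / q) = epowr (G x) (1 / q' + 1 / q)"
      by (rule epowr_add[symmetric])
    then show ?thesis by (simp add: q' epowr_1 mult_ac)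
  qed
  then have "(\<integral>\<^sup>+ x. F x * G x \<partial>M) = (\<integral>\<^sup>+ x. epowr (G x) (1 / q') * (F x * epowr (G x) (1 / q)) \<partial>M)"
    by simp
  also have "\<dots> \<le> epowr (\<integral>\<^sup>+ x. epowr (epowr (G x) (1 / q')) q' \<partial>M) (1 / q') *
      epowr (\<integral>\<^sup>+ x. epowr (F x * epowr (G x) (1 / q)) q \<partial>M) (1 / q)"
    using q q' by (intro nn_integral_Holder) auto
  also have "\<dots> = epowr (\<integral>\<^sup>+ x. G x \<partial>M) (1 / q') * epowr (\<integral>\<^sup>+ x. epowr (F x) q * G x \<partial>M) (1 / q)"
    using q q'(1) by (simp add: epowr_epowr epowr_mult epowr_1)
  finally have "epowr (\<integral>\<^sup>+ x. F x * G x \<partial>M) q \<le>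
      epowr (epowr (\<integral>\<^sup>+ x. G x \<partial>M) (1 / q') * epowr (\<integral>\<^sup>+ x. epowr (F x) q * G x \<partial>M) (1 / q)) q"
    using q by (intro epowr_mono) auto
  also have "\<dots> = (\<integral>\<^sup>+ x. epowr (F x) q * G x \<partial>M) * epowr (\<integral>\<^sup>+ x. G x \<partial>M) (q - 1)"
    using q by (simp add: epowr_mult epowr_epowr epowr_1 mult.commute q'_def)
  finally show ?thesis .
qed

subsection \<open>Auerbach bases\<close>

lemma continuous_on_det:
  fixes f :: "'x::topological_space \<Rightarrow> complex ^ 'n ^ 'n"
  assumes "continuous_on T f"
  shows "continuous_on T (\<lambda>x. det (f x))"
  unfolding det_def by (intro continuous_intros assms)

text \<open>An Auerbach basis: among matrices whose columns lie in the unit ball of \<open>N\<close>, one of maximal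
  \<open>\<bar>det\<bar>\<close> has coordinate functionals bounded by \<open>N\<close>, by Cramer's rule. It plays the role of the
  reducing matrix of \<open>N\<close>, and the triangle inequality for \<open>N\<close> is not needed.\<close>

lemma auerbach_basis:
  fixes N :: "complex ^ 'n \<Rightarrow> real"
  assumes cont: "continuous_on UNIV N"
    and hom: "\<And>r v. 0 \<le> r \<Longrightarrow> N (r *\<^sub>R v) = r * N v"
    and pos: "\<And>v. v \<noteq> 0 \<Longrightarrow> 0 < N v"
  obtains B T :: "complex ^ 'n ^ 'n" where "B ** T = mat 1" "\<forall>j. N (B *v axis j 1) \<le> 1"
    "\<forall>v i. cmod ((T *v v) $ i) \<le> N v"
proof -
  have N0: "N 0 = 0" using hom[of 0 0] by simp
  \<comment> \<open>Comparison of \<open>N\<close> with the Euclidean norm, from its minimum on the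
    unit sphere and homogeneity. It bounds the columns of the matrices in \<open>K\<close> below,
    hence gives compactness.\<close>
  have "\<exists>m>0. \<forall>v. m * norm v \<le> N v"
  proof -
    have ne: "sphere (0 :: complex ^ 'n) 1 \<noteq> {}"
      by (metis empty_iff mem_sphere_0 norm_axis_eq norm_one)
    obtain u where u: "u \<in> sphere 0 1" "\<And>v. v \<in> sphere 0 1 \<Longrightarrow> N u \<le> N v"
      using continuous_attains_inf[OF compact_sphere ne continuous_on_subset[OF cont subset_UNIV]] by blast
    have "N u * norm v \<le> N v" for v
    proof (cases "v = 0")
      case False
      have "N v = norm v * N ((1 / norm v) *\<^sub>R v)"
        using False hom[of "norm v" "(1 / norm v) *\<^sub>R v"] by simp
      also have "\<dots> \<ge> norm v * N u"
        using False by (intro mult_left_mono u(2)) auto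
      finally show ?thesis by (simp add: mult.commute)
    qed (simp add: N0)
    moreover have "0 < N u" using u(1) by (intro pos) auto
    ultimately show ?thesis by blast
  qed
  then obtain m where m: "0 < m" "\<And>v. m * norm v \<le> N v" by blast
  define K where "K = {B :: complex ^ 'n ^ 'n. \<forall>j. N (column j B) \<le> 1}"
  have "compact K"
    unfolding compact_eq_bounded_closed
  proof
    have "norm B \<le> (\<Sum>i\<in>(UNIV :: 'n set). \<Sum>j\<in>(UNIV :: 'n set). 1 / m)" if "B \<in> K" for B
    proof -
      have "cmod (B $ i $ j) \<le> 1 / m" for i j
      proof -
        have "m * norm (column j B) \<le> 1" using m(2)[of "column j B"] that
          by (auto simp: K_def intro: order_trans)
        moreover have "m * cmod (B $ i $ j) \<le> m * norm (column j B)"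
          using m(1) Finite_Cartesian_Product.norm_nth_le[of "column j B" i] by (simp add: column_def)
        ultimately have "m * cmod (B $ i $ j) \<le> 1" by linarith
        then show ?thesis using m(1) by (simp add: field_simps)
      qed
      then show ?thesis by (intro order_trans[OF norm_matrix_le_sum] sum_mono)
    qed
    then show "bounded K" unfolding bounded_iff by blast
    have "continuous_on UNIV (\<lambda>B :: complex ^ 'n ^ 'n. N (column j B))" for j
      unfolding column_def by (intro continuous_on_compose2[OF cont] continuous_intros) auto
    then show "closed K"
      unfolding K_def by (intro closed_Collect_all closed_Collect_le continuous_intros)
  qed
  moreover have "0 \<in> K"
  proof -
    have "column j 0 = (0 :: complex ^ 'n)" for j :: 'n by (simp add: column_def vec_eq_iff)
    then show ?thesis by (simp add: K_def N0)
  qed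
  moreover have "continuous_on K (\<lambda>B. cmod (det B))"
    by (intro continuous_intros continuous_on_det)
  ultimately obtain B where B: "B \<in> K" and max: "\<And>A. A \<in> K \<Longrightarrow> cmod (det A) \<le> cmod (det B)"
    using continuous_attains_sup[of K "\<lambda>B. cmod (det B)"] by blast
  \<comment> \<open>A small multiple of the identity is an admissible competitor with nonzero
    determinant; \<open>t\<close> is chosen so that each of its columns has \<open>N\<close> at most
    \<open>s / (1 + s)\<close>.\<close>
  have "det B \<noteq> 0"
  proof -
    define s where "s = (\<Sum>j\<in>UNIV. N (axis j (1 :: complex)))"
    have Nn: "0 \<le> N v" for v using pos[of v] N0 by (cases "v = 0") auto
    have s: "N (axis j 1) \<le> s" for j unfolding s_def by (rule member_le_sum) (auto simp: Nn)
    have s0: "0 \<le> s" unfolding s_def by (intro sum_nonneg Nn)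
    define t where "t = 1 / (1 + s)"
    have t: "0 < t" using s0 by (simp add: t_def)
    define A :: "complex ^ 'n ^ 'n" where "A = (\<chi> i j. if i = j then of_real t else 0)"
    have "column j A = t *\<^sub>R axis j 1" for j
      by (auto simp: A_def column_def axis_def vec_eq_iff) (simp_all add: scaleR_conv_of_real)
    then have "N (column j A) = N (axis j 1) / (1 + s)" for j using hom t by (simp add: t_def)
    then have "A \<in> K" using s s0 by (auto simp: K_def divide_le_eq intro: order_trans[of _ s])
    moreover have "det A \<noteq> 0"
      using t by (subst det_diagonal) (auto simp: A_def)
    ultimately show ?thesis using max by fastforce
  qed
  then obtain T where T: "B ** T = mat 1"
    using invertible_det_nz[of B] invertible_right_inverse[of B] by blast
  \<comment> \<open>Replacing column \<open>k\<close> of \<open>B\<close> by \<open>v\<close> stays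
    inside \<open>K\<close> and multiplies the determinant by the \<open>k\<close>-th coordinate of
    \<open>v\<close>, so maximality bounds that coordinate by \<open>1\<close>.\<close>
  have unit: "cmod ((T *v v) $ k) \<le> 1" if v: "N v \<le> 1" for v k
  proof -
    define A where "A = (\<chi> i j. if j = k then (B *v (T *v v)) $ i else B $ i $ j)"
    have "B *v (T *v v) = v" using T by (simp add: matrix_vector_mul_assoc)
    then have "column j A = (if j = k then v else column j B)" for j
      by (simp add: A_def column_def vec_eq_iff)
    then have "A \<in> K" using B v by (simp add: K_def)
    then have "cmod (det A) \<le> cmod (det B)" by (rule max)
    also have "det A = (T *v v) $ k * det B" unfolding A_def by (rule cramer_lemma)
    finally show ?thesis using \<open>det B \<noteq> 0\<close> by (simp add: norm_mult)
  qed
  have coord: "cmod ((T *v v) $ i) \<le> N v" for v i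
  proof (cases "v = 0")
    case False
    have hom_T: "T *v (r *\<^sub>R v) = r *\<^sub>R (T *v v)" for r
      by (simp add: linear_cmul)
    have "N ((1 / N v) *\<^sub>R v) \<le> 1" using pos[OF False] by (subst hom) auto
    then have "cmod ((T *v ((1 / N v) *\<^sub>R v)) $ i) \<le> 1" by (rule unit)
    then show ?thesis using pos[OF False] by (simp add: hom_T field_simps)
  qed (simp add: N0)
  have col: "N (B *v axis j 1) \<le> 1" for j
    using B by (simp add: K_def matrix_vector_axis)
  show ?thesis using that T col coord by blast
qed

section \<open>Measurability of matrix operations\<close>

lemma borel_measurable_matrix_mult [measurable (raw)]:
  fixes f :: "'x \<Rightarrow> complex ^ 'n ^ 'm" and g :: "'x \<Rightarrow> complex ^ 'k ^ 'n"
  assumes "f \<in> borel_measurable M" "g \<in> borel_measurable M"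
  shows "(\<lambda>x. f x ** g x) \<in> borel_measurable M"
  by (rule borel_measurable_continuous_Pair[OF assms]) (intro continuous_intros)

lemma borel_measurable_matrix_vector_mult [measurable (raw)]:
  fixes f :: "'x \<Rightarrow> complex ^ 'n ^ 'm" and g :: "'x \<Rightarrow> complex ^ 'n"
  assumes "f \<in> borel_measurable M" "g \<in> borel_measurable M"
  shows "(\<lambda>x. f x *v g x) \<in> borel_measurable M"
  by (rule borel_measurable_continuous_Pair[OF assms])
    (unfold matrix_vector_mult_def, intro continuous_intros)

lemma borel_measurable_matrix_opnorm [measurable (raw)]:
  assumes "f \<in> borel_measurable M"
  shows "(\<lambda>x. matrix_opnorm (f x)) \<in> borel_measurable M"
  using continuous_on_matrix_opnorm assms by (rule borel_measurable_continuous_on)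

lemma borel_measurable_vec_nth [measurable (raw)]:
  fixes f :: "'x \<Rightarrow> 'a::euclidean_space ^ 'n"
  assumes "f \<in> borel_measurable M"
  shows "(\<lambda>x. f x $ i) \<in> borel_measurable M"
  by (rule borel_measurable_continuous_on[OF _ assms]) (intro continuous_intros)

subsection \<open>Bounds for the averages\<close>

lemma integral_matrix_vector_mult:
  fixes f :: "'x \<Rightarrow> complex ^ 'n" and A :: "complex ^ 'n ^ 'm"
  assumes "integrable M f"
  shows "integrable M (\<lambda>x. A *v f x)" "A *v (\<integral>x. f x \<partial>M) = (\<integral>x. A *v f x \<partial>M)"
proof -
  have bl: "bounded_linear ((*v) A)" by simp
  show "integrable M (\<lambda>x. A *v f x)" using integrable_bounded_linear[OF bl assms] .
  show "A *v (\<integral>x. f x \<partial>M) = (\<integral>x. A *v f x \<partial>M)"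
    using integral_bounded_linear[OF bl assms] by simp
qed

text \<open>\<open>A\<close> stands for \<open>X x\<close> at a fixed \<open>x\<close>; inserting
  \<open>Y y ** Z y\<close> between \<open>A\<close> and \<open>f y\<close> separates the kernel
  from the weighted function. For non-integrable \<open>f\<close> the left-hand side is
  \<open>0\<close> by convention.\<close>

lemma averaging_pointwise_bound:
  fixes f :: "'x \<Rightarrow> complex ^ 'n" and Y Z :: "'x \<Rightarrow> complex ^ 'n ^ 'n"
  assumes f[measurable]: "f \<in> borel_measurable M"
    and YZ: "AE y in M. Y y ** Z y = mat 1"
  shows "ennreal (norm (A *v (\<integral>y. f y \<partial>M)))
    \<le> (\<integral>\<^sup>+ y. ennreal (matrix_opnorm (A ** Y y)) * ennreal (norm (Z y *v f y)) \<partial>M)"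
proof (cases "integrable M f")
  case True
  have "ennreal (norm (A *v (\<integral>y. f y \<partial>M))) \<le> (\<integral>\<^sup>+ y. ennreal (norm (A *v f y)) \<partial>M)"
    unfolding integral_matrix_vector_mult(2)[OF True]
    by (rule integral_norm_bound_ennreal[OF integral_matrix_vector_mult(1)[OF True]])
  also have "\<dots> \<le> (\<integral>\<^sup>+ y. ennreal (matrix_opnorm (A ** Y y)) * ennreal (norm (Z y *v f y)) \<partial>M)"
  proof (rule nn_integral_mono_AE)
    show "AE y in M. ennreal (norm (A *v f y))
        \<le> ennreal (matrix_opnorm (A ** Y y)) * ennreal (norm (Z y *v f y))"
      using YZ
    proof eventually_elim
      fix y assume "Y y ** Z y = mat 1"
      then have "A *v f y = (A ** Y y) *v (Z y *v f y)"
        by (simp add: matrix_vector_mul_assoc matrix_mul_assoc[symmetric])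
      then have "norm (A *v f y) \<le> matrix_opnorm (A ** Y y) * norm (Z y *v f y)"
        using norm_matrix_vector_le by metis
      then show "ennreal (norm (A *v f y)) \<le> ennreal (matrix_opnorm (A ** Y y)) * ennreal (norm (Z y *v f y))"
        by (simp add: ennreal_mult[symmetric] matrix_opnorm_nonneg ennreal_leI)
    qed
  qed
  finally show ?thesis .
qed (simp add: not_integrable_integral_eq)

text \<open>Multiplying by a left inverse of \<open>A\<close> recovers \<open>f\<close> from
  \<open>A Y Z f\<close>, so finiteness of the kernel integral at a single good point already gives
  integrability of \<open>f\<close>.\<close>

lemma averaging_integrable:
  fixes f :: "'x \<Rightarrow> complex ^ 'n" and Y Z :: "'x \<Rightarrow> complex ^ 'n ^ 'n"
  assumes [measurable]: "f \<in> borel_measurable M" "Y \<in> borel_measurable M" "Z \<in> borel_measurable M"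
    and YZ: "AE y in M. Y y ** Z y = mat 1"
    and fin: "(\<integral>\<^sup>+ y. ennreal (matrix_opnorm (A ** Y y)) * ennreal (norm (Z y *v f y)) \<partial>M) < \<infinity>"
    and L: "L ** A = mat 1"
  shows "integrable M f"
proof (rule integrableI_bounded)
  have "(\<integral>\<^sup>+ y. ennreal (norm (f y)) \<partial>M) \<le> (\<integral>\<^sup>+ y. ennreal (matrix_opnorm L) *
      (ennreal (matrix_opnorm (A ** Y y)) * ennreal (norm (Z y *v f y))) \<partial>M)"
  proof (rule nn_integral_mono_AE)
    show "AE y in M. ennreal (norm (f y)) \<le> ennreal (matrix_opnorm L) *
        (ennreal (matrix_opnorm (A ** Y y)) * ennreal (norm (Z y *v f y)))"
      using YZ
    proof eventually_elim
      fix y assume YZ: "Y y ** Z y = mat 1"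
      have "f y = (L ** (A ** (Y y ** Z y))) *v f y" using L YZ by simp
      also have "\<dots> = L *v ((A ** Y y) *v (Z y *v f y))"
        by (simp add: matrix_vector_mul_assoc matrix_mul_assoc)
      finally have "norm (f y) \<le> matrix_opnorm L * norm ((A ** Y y) *v (Z y *v f y))"
        using norm_matrix_vector_le by metis
      also have "\<dots> \<le> matrix_opnorm L * (matrix_opnorm (A ** Y y) * norm (Z y *v f y))"
        by (intro mult_left_mono norm_matrix_vector_le matrix_opnorm_nonneg)
      finally show "ennreal (norm (f y)) \<le> ennreal (matrix_opnorm L) *
          (ennreal (matrix_opnorm (A ** Y y)) * ennreal (norm (Z y *v f y)))"
        by (simp add: ennreal_mult[symmetric] matrix_opnorm_nonneg ennreal_leI)
    qed
  qed
  also have "\<dots> = ennreal (matrix_opnorm L) *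
      (\<integral>\<^sup>+ y. ennreal (matrix_opnorm (A ** Y y)) * ennreal (norm (Z y *v f y)) \<partial>M)"
    by (rule nn_integral_cmult) measurable
  also have "\<dots> < \<infinity>" using fin by (simp add: ennreal_mult_less_top)
  finally show "(\<integral>\<^sup>+ y. ennreal (norm (f y)) \<partial>M) < \<infinity>" .
qed simp

text \<open>A majorant for the \<open>q\<close>-th power of the \<open>X\<close>-weighted norm of
  the unnormalised average. The norms stand inside the inner integral, so that finiteness also
  yields integrability of \<open>f\<close>.\<close>

definition kernel_bound where
  "kernel_bound M q X Y Z f = (\<integral>\<^sup>+ x. epowr (\<integral>\<^sup>+ y. ennreal (matrix_opnorm (X x ** Y y)) *
      ennreal (norm (Z y *v f y)) \<partial>M) q \<partial>M)"

lemma averaging_norm_le_kernel_bound: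
  fixes f :: "'x \<Rightarrow> complex ^ 'n" and X Y Z :: "'x \<Rightarrow> complex ^ 'n ^ 'n"
  assumes "f \<in> borel_measurable M" "AE y in M. Y y ** Z y = mat 1" "0 \<le> q"
  shows "(\<integral>\<^sup>+ x. ennreal (norm (X x *v (\<integral>y. f y \<partial>M)) powr q) \<partial>M) \<le> kernel_bound M q X Y Z f"
  unfolding kernel_bound_def
  by (intro nn_integral_mono)
    (simp add: epowr_ennreal[symmetric] epowr_mono averaging_pointwise_bound assms)

text \<open>Hoelder's inequality in \<open>y\<close> for each fixed \<open>x\<close>; the factor
  containing \<open>f\<close> is independent of \<open>x\<close> and leaves the outer
  integral.\<close>

lemma kernel_bound_holder:
  fixes f :: "'x \<Rightarrow> complex ^ 'n" and X Y Z :: "'x \<Rightarrow> complex ^ 'n ^ 'n"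
  assumes "sigma_finite_measure M" and [measurable]: "f \<in> borel_measurable M"
      "X \<in> borel_measurable M" "Y \<in> borel_measurable M" "Z \<in> borel_measurable M"
    and p: "1 < p" "1 < p'" "1 / p' + 1 / p = 1" and q: "0 \<le> q"
  shows "kernel_bound M q X Y Z f \<le>
    (\<integral>\<^sup>+ x. epowr (\<integral>\<^sup>+ y. ennreal (matrix_opnorm (X x ** Y y) powr p') \<partial>M) (q / p') \<partial>M) *
    epowr (\<integral>\<^sup>+ y. ennreal (norm (Z y *v f y) powr p) \<partial>M) (q / p)"
proof -
  interpret M: sigma_finite_measure M by fact
  let ?N = "\<integral>\<^sup>+ y. ennreal (norm (Z y *v f y) powr p) \<partial>M"
  have bound: "epowr (\<integral>\<^sup>+ y. ennreal (matrix_opnorm (X x ** Y y)) * ennreal (norm (Z y *v f y)) \<partial>M) q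
      \<le> epowr (\<integral>\<^sup>+ y. ennreal (matrix_opnorm (X x ** Y y) powr p') \<partial>M) (q / p') * epowr ?N (q / p)" for x
  proof -
    have "(\<integral>\<^sup>+ y. ennreal (matrix_opnorm (X x ** Y y)) * ennreal (norm (Z y *v f y)) \<partial>M)
      \<le> epowr (\<integral>\<^sup>+ y. epowr (ennreal (matrix_opnorm (X x ** Y y))) p' \<partial>M) (1 / p') *
        epowr (\<integral>\<^sup>+ y. epowr (ennreal (norm (Z y *v f y))) p \<partial>M) (1 / p)"
      using p by (intro nn_integral_Holder) measurable
    from epowr_mono[OF this q] show ?thesis
      by (simp add: epowr_ennreal matrix_opnorm_nonneg epowr_mult epowr_epowr)
  qed
  have "kernel_bound M q X Y Z f \<le> (\<integral>\<^sup>+ x. epowr (\<integral>\<^sup>+ y. ennreal (matrix_opnorm (X x ** Y y) powr p') \<partial>M) (q / p')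
      * epowr ?N (q / p) \<partial>M)"
    unfolding kernel_bound_def by (intro nn_integral_mono bound)
  also have "\<dots> = (\<integral>\<^sup>+ x. epowr (\<integral>\<^sup>+ y. ennreal (matrix_opnorm (X x ** Y y) powr p') \<partial>M) (q / p') \<partial>M) *
      epowr ?N (q / p)"
    by (rule nn_integral_multc) measurable
  finally show ?thesis .
qed

text \<open>Jensen's inequality with weight \<open>norm (Z y *v f y)\<close> moves the power
  \<open>q\<close> onto the kernel, and Tonelli's theorem brings the integral over \<open>x\<close>
  inside, where \<open>K\<close> applies. The power \<open>q - 1\<close> of the total weight from
  Jensen and one more from the integral against \<open>K\<close> recombine to
  \<open>q\<close>.\<close>

lemma kernel_bound_jensen:
  fixes f :: "'x \<Rightarrow> complex ^ 'n" and X Y Z :: "'x \<Rightarrow> complex ^ 'n ^ 'n"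
  assumes "sigma_finite_measure M" and [measurable]: "f \<in> borel_measurable M"
      "X \<in> borel_measurable M" "Y \<in> borel_measurable M" "Z \<in> borel_measurable M"
    and q: "1 \<le> q"
    and K: "AE y in M. (\<integral>\<^sup>+ x. ennreal (matrix_opnorm (X x ** Y y) powr q) \<partial>M) \<le> K"
  shows "kernel_bound M q X Y Z f \<le> K * epowr (\<integral>\<^sup>+ y. ennreal (norm (Z y *v f y)) \<partial>M) q"
proof -
  interpret M: sigma_finite_measure M by fact
  interpret P: pair_sigma_finite M M ..
  let ?g = "\<lambda>y. ennreal (norm (Z y *v f y))"
  let ?N = "\<integral>\<^sup>+ y. ?g y \<partial>M"
  have "epowr (\<integral>\<^sup>+ y. ennreal (matrix_opnorm (X x ** Y y)) * ?g y \<partial>M) q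
      \<le> (\<integral>\<^sup>+ y. ennreal (matrix_opnorm (X x ** Y y) powr q) * ?g y \<partial>M) * epowr ?N (q - 1)" for x
    using nn_integral_weighted_power_le[of "\<lambda>y. ennreal (matrix_opnorm (X x ** Y y))" M ?g q] q
    by (simp add: epowr_ennreal matrix_opnorm_nonneg)
  then have "kernel_bound M q X Y Z f
      \<le> (\<integral>\<^sup>+ x. (\<integral>\<^sup>+ y. ennreal (matrix_opnorm (X x ** Y y) powr q) * ?g y \<partial>M) * epowr ?N (q - 1) \<partial>M)"
    unfolding kernel_bound_def by (intro nn_integral_mono)
  also have "\<dots> = (\<integral>\<^sup>+ x. (\<integral>\<^sup>+ y. ennreal (matrix_opnorm (X x ** Y y) powr q) * ?g y \<partial>M) \<partial>M) * epowr ?N (q - 1)"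
    by (rule nn_integral_multc) measurable
  also have "(\<integral>\<^sup>+ x. (\<integral>\<^sup>+ y. ennreal (matrix_opnorm (X x ** Y y) powr q) * ?g y \<partial>M) \<partial>M)
      = (\<integral>\<^sup>+ y. (\<integral>\<^sup>+ x. ennreal (matrix_opnorm (X x ** Y y) powr q) * ?g y \<partial>M) \<partial>M)"
    by (rule P.Fubini') measurable
  also have "\<dots> = (\<integral>\<^sup>+ y. (\<integral>\<^sup>+ x. ennreal (matrix_opnorm (X x ** Y y) powr q) \<partial>M) * ?g y \<partial>M)"
    by (intro nn_integral_cong nn_integral_multc) measurable
  also have "\<dots> \<le> (\<integral>\<^sup>+ y. K * ?g y \<partial>M)"
    using K by (intro nn_integral_mono_AE) (auto elim!: eventually_mono intro: mult_right_mono)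
  also have "\<dots> = K * ?N" by (rule nn_integral_cmult) measurable
  also have "K * ?N * epowr ?N (q - 1) = K * epowr ?N q"
    using epowr_add[of ?N 1 "q - 1"] by (simp add: epowr_1 mult.assoc)
  finally show ?thesis by (simp add: mult_right_mono)
qed

text \<open>For almost every \<open>x\<close> the inner integral is finite and \<open>X x\<close>
  has a left inverse. Since the space has nonzero measure, such an \<open>x\<close> exists, and the
  conclusion no longer mentions it.\<close>

lemma kernel_bound_integrable:
  fixes f :: "'x \<Rightarrow> complex ^ 'n" and X Y Z :: "'x \<Rightarrow> complex ^ 'n ^ 'n"
  assumes "sigma_finite_measure M" and [measurable]: "f \<in> borel_measurable M"
      "X \<in> borel_measurable M" "Y \<in> borel_measurable M" "Z \<in> borel_measurable M"
    and YZ: "AE y in M. Y y ** Z y = mat 1"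
    and X: "AE x in M. \<exists>L. L ** X x = mat 1"
    and fin: "kernel_bound M q X Y Z f < \<infinity>"
    and M: "emeasure M (space M) \<noteq> 0"
  shows "integrable M f"
proof -
  interpret M: sigma_finite_measure M by fact
  have "AE x in M. epowr (\<integral>\<^sup>+ y. ennreal (matrix_opnorm (X x ** Y y)) *
      ennreal (norm (Z y *v f y)) \<partial>M) q \<noteq> \<infinity>"
    using fin unfolding kernel_bound_def by (intro nn_integral_noteq_infinite) auto
  with X have "AE x in M. integrable M f"
  proof eventually_elim
    fix x assume L: "\<exists>L. L ** X x = mat 1"
      and fin: "epowr (\<integral>\<^sup>+ y. ennreal (matrix_opnorm (X x ** Y y)) * ennreal (norm (Z y *v f y)) \<partial>M) q \<noteq> \<infinity>"
    then have "(\<integral>\<^sup>+ y. ennreal (matrix_opnorm (X x ** Y y)) * ennreal (norm (Z y *v f y)) \<partial>M) < \<infinity>"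
      by (cases "(\<integral>\<^sup>+ y. ennreal (matrix_opnorm (X x ** Y y)) * ennreal (norm (Z y *v f y)) \<partial>M)") auto
    moreover obtain L where "L ** X x = mat 1" using L by blast
    ultimately show "integrable M f" by (intro averaging_integrable[OF _ _ _ YZ, of f "X x" L]) measurable
  qed
  moreover have "ae_filter M \<noteq> bot" using M by (simp add: ae_filter_eq_bot_iff)
  ultimately show ?thesis using eventually_const by blast
qed

subsection \<open>Duality\<close>

text \<open>The pairing in the duality lemmas is bilinear, without conjugation, so the extremal test
  vector for \<open>v\<close> is a multiple of its entrywise conjugate.\<close>

lemma dual_pairing:
  fixes v :: "complex ^ 'n"
  shows "(\<Sum>j\<in>UNIV. v $ j * (c *\<^sub>R (\<chi> j. cnj (v $ j))) $ j) = complex_of_real (c * (norm v)\<^sup>2)"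
    and "norm (c *\<^sub>R (\<chi> j. cnj (v $ j))) = \<bar>c\<bar> * norm v"
proof -
  have "(\<Sum>j\<in>UNIV. v $ j * (c *\<^sub>R (\<chi> j. cnj (v $ j))) $ j) = of_real c * cdot v v"
    by (simp add: cdot_def sum_distrib_left) (simp add: scaleR_conv_of_real mult_ac)
  then show "(\<Sum>j\<in>UNIV. v $ j * (c *\<^sub>R (\<chi> j. cnj (v $ j))) $ j) = complex_of_real (c * (norm v)\<^sup>2)"
    by (simp add: cdot_self)
  have "norm (\<chi> j. cnj (v $ j)) = norm v" by (simp add: norm_vec_def)
  then show "norm (c *\<^sub>R (\<chi> j. cnj (v $ j))) = \<bar>c\<bar> * norm v" by simp
qed

lemma borel_measurable_vec_cnj [measurable (raw)]:
  assumes "h \<in> borel_measurable M"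
  shows "(\<lambda>x. (\<chi> j. cnj (h x $ j)) :: complex ^ 'n) \<in> borel_measurable M"
  by (rule borel_measurable_continuous_on[OF _ assms]) (intro continuous_intros)

text \<open>Converse of Hoelder's inequality. The extremal \<open>g\<close> is
  \<open>norm h powr (p' - 2)\<close> times the conjugate of \<open>h\<close>, cut off where
  \<open>norm h\<close> exceeds \<open>k\<close>: finiteness of the integral of
  \<open>\<phi> k\<close> is not known beforehand without the cut-off, and the argument divides by a
  power of it. Fatou's lemma then removes the cut-off.\<close>

lemma Lp_norm_le_dual:
  fixes h :: "'x \<Rightarrow> complex ^ 'n"
  assumes "finite_measure M" and [measurable]: "h \<in> borel_measurable M"
    and p: "1 < p" "1 < p'" "1 / p' + 1 / p = 1" and K: "0 \<le> K"
    and H: "\<And>g. g \<in> borel_measurable M \<Longrightarrow> (\<integral>\<^sup>+ y. ennreal (norm (g y) powr p) \<partial>M) < \<infinity> \<Longrightarrow>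
      ennreal (cmod (\<integral>y. (\<Sum>j\<in>UNIV. h y $ j * g y $ j) \<partial>M))
        \<le> ennreal K * epowr (\<integral>\<^sup>+ y. ennreal (norm (g y) powr p) \<partial>M) (1 / p)"
  shows "(\<integral>\<^sup>+ y. ennreal (norm (h y) powr p') \<partial>M) \<le> ennreal (K powr p')"
proof -
  interpret finite_measure M by fact
  have pp: "(p' - 1) * p = p'" using p by (simp add: field_simps)
  define \<phi> where "\<phi> k y = (if norm (h y) \<le> real k then norm (h y) powr p' else 0)" for k y
  have \<phi>_meas[measurable]: "\<phi> k \<in> borel_measurable M" for k unfolding \<phi>_def by measurable
  have trunc: "(\<integral>\<^sup>+ y. ennreal (\<phi> k y) \<partial>M) \<le> ennreal (K powr p')" for k
  proof -
    define c where "c y = (if norm (h y) \<le> real k then norm (h y) powr (p' - 2) else 0)" for y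
    define g where "g y = c y *\<^sub>R (\<chi> j. cnj (h y $ j))" for y
    have [measurable]: "c \<in> borel_measurable M" unfolding c_def by measurable
    have g[measurable]: "g \<in> borel_measurable M" unfolding g_def by measurable
    \<comment> \<open>Zeros of \<open>h\<close> do no harm even for \<open>p' < 2\<close>, because
      \<open>0 powr (p' - 2) = 0\<close>.\<close>
    have "norm (h y) powr (p' - 2) * (norm (h y))\<^sup>2 = norm (h y) powr p'" for y
      using powr_add[of "norm (h y)" "p' - 2" 2] by (cases "h y = 0") (simp_all add: powr_realpow)
    then have pair: "(\<Sum>j\<in>UNIV. h y $ j * g y $ j) = complex_of_real (\<phi> k y)" for y
      unfolding g_def dual_pairing of_real_eq_iff by (simp add: c_def \<phi>_def)
    have "norm (h y) powr (p' - 2) * norm (h y) = norm (h y) powr (p' - 1)" for y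
      using powr_add[of "norm (h y)" "p' - 2" 1] by (cases "h y = 0") simp_all
    then have ng: "norm (g y) powr p = \<phi> k y" for y
      unfolding g_def dual_pairing by (simp add: c_def \<phi>_def powr_powr pp)
    have int: "integrable M (\<phi> k)"
    proof (rule integrable_const_bound)
      show "AE y in M. norm (\<phi> k y) \<le> real k powr p'"
        using p by (auto simp: \<phi>_def intro!: powr_mono2)
    qed simp
    define I where "I = (\<integral>y. \<phi> k y \<partial>M)"
    have I: "(\<integral>\<^sup>+ y. ennreal (\<phi> k y) \<partial>M) = ennreal I" and I0: "0 \<le> I"
      unfolding I_def by (intro nn_integral_eq_integral[OF int] Bochner_Integration.integral_nonneg, simp_all add: \<phi>_def)
    have "ennreal (cmod (\<integral>y. complex_of_real (\<phi> k y) \<partial>M)) \<le> ennreal K * epowr (ennreal I) (1 / p)"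
      using H[OF g] unfolding pair ng I by simp
    then have "ennreal I \<le> ennreal (K * I powr (1 / p))"
      using I0 K by (simp add: I_def[symmetric] epowr_ennreal ennreal_mult)
    then have le: "I \<le> K * I powr (1 / p)" using K by simp
    have "I \<le> K powr p'"
    proof (cases "I = 0")
      case False
      then have "I powr (1 / p') * I powr (1 / p) = I"
        using I0 p by (simp add: powr_add[symmetric])
      then have "I powr (1 / p') \<le> K" using le False I0
        by (metis mult_le_cancel_right_pos powr_gt_zero)
      then have "(I powr (1 / p')) powr p' \<le> K powr p'" using p by (intro powr_mono2) auto
      then show ?thesis using I0 p by (simp add: powr_powr)
    qed simp
    then show ?thesis unfolding I by (rule ennreal_leI)
  qed
  have "(\<lambda>k. ennreal (\<phi> k y)) \<longlonglongrightarrow> ennreal (norm (h y) powr p')" for y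
  proof (rule tendsto_eventually)
    obtain k0 where "norm (h y) \<le> real k0" using real_arch_simple by blast
    then have "ennreal (\<phi> k y) = ennreal (norm (h y) powr p')" if "k0 \<le> k" for k
      using that by (simp add: \<phi>_def)
    then show "\<forall>\<^sub>F k in sequentially. ennreal (\<phi> k y) = ennreal (norm (h y) powr p')"
      unfolding eventually_sequentially by blast
  qed
  then have "(\<integral>\<^sup>+ y. ennreal (norm (h y) powr p') \<partial>M) = (\<integral>\<^sup>+ y. liminf (\<lambda>k. ennreal (\<phi> k y)) \<partial>M)"
    by (intro nn_integral_cong) (metis lim_imp_Liminf sequentially_bot)
  also have "\<dots> \<le> liminf (\<lambda>k. \<integral>\<^sup>+ y. ennreal (\<phi> k y) \<partial>M)"
    by (rule nn_integral_liminf) measurable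
  also have "\<dots> \<le> ennreal (K powr p')"
    by (rule Liminf_le) (simp_all add: trunc)
  finally show ?thesis .
qed

text \<open>Endpoint case: testing with the unit field \<open>cnj h / norm h\<close> on the set
  where \<open>K < norm h \<le> real k\<close> shows that \<open>norm h - K\<close> has nonpositive
  integral there, though it is positive, so the set is null. The cap \<open>k\<close> ensures
  integrability, and countably many caps exhaust the set where \<open>norm h\<close> exceeds
  \<open>K\<close>.\<close>

lemma AE_norm_le_dual:
  fixes h :: "'x \<Rightarrow> complex ^ 'n"
  assumes "finite_measure M" and [measurable]: "h \<in> borel_measurable M" and K: "0 \<le> K"
    and H: "\<And>g. g \<in> borel_measurable M \<Longrightarrow> (\<integral>\<^sup>+ y. ennreal (norm (g y)) \<partial>M) < \<infinity> \<Longrightarrow>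
      ennreal (cmod (\<integral>y. (\<Sum>j\<in>UNIV. h y $ j * g y $ j) \<partial>M))
        \<le> ennreal K * (\<integral>\<^sup>+ y. ennreal (norm (g y)) \<partial>M)"
  shows "AE y in M. norm (h y) \<le> K"
proof -
  interpret finite_measure M by fact
  have "AE y in M. \<not> (K < norm (h y) \<and> norm (h y) \<le> real k)" for k
  proof -
    define P where "P y \<longleftrightarrow> K < norm (h y) \<and> norm (h y) \<le> real k" for y
    have [measurable]: "Measurable.pred M P" unfolding P_def by measurable
    define \<phi> where "\<phi> y = (if P y then norm (h y) else 0)" for y
    define \<iota> where "\<iota> y = (if P y then 1 else 0 :: real)" for y
    define c where "c y = (if P y then 1 / norm (h y) else 0)" for y
    define g where "g y = c y *\<^sub>R (\<chi> j. cnj (h y $ j))" for y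
    have [measurable]: "c \<in> borel_measurable M" "\<phi> \<in> borel_measurable M" "\<iota> \<in> borel_measurable M"
      unfolding c_def \<phi>_def \<iota>_def by measurable
    have g[measurable]: "g \<in> borel_measurable M" unfolding g_def by measurable
    have pair: "(\<Sum>j\<in>UNIV. h y $ j * g y $ j) = complex_of_real (\<phi> y)" for y
      unfolding g_def dual_pairing using K by (auto simp: c_def \<phi>_def P_def power2_eq_square)
    have ng: "norm (g y) = \<iota> y" for y
      unfolding g_def dual_pairing using K by (auto simp: c_def \<iota>_def P_def)
    have int: "integrable M \<phi>" "integrable M \<iota>"
      by (rule integrable_const_bound[of _ "real k"], auto simp: \<phi>_def P_def)
        (rule integrable_const_bound[of _ 1], auto simp: \<iota>_def)
    have I: "(\<integral>\<^sup>+ y. ennreal (\<iota> y) \<partial>M) = ennreal (\<integral>y. \<iota> y \<partial>M)"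
      by (intro nn_integral_eq_integral int) (simp add: \<iota>_def)
    have "0 \<le> (\<integral>y. \<phi> y \<partial>M)" "0 \<le> (\<integral>y. \<iota> y \<partial>M)"
      by (auto intro!: Bochner_Integration.integral_nonneg simp: \<phi>_def \<iota>_def)
    then have "(\<integral>y. \<phi> y \<partial>M) \<le> K * (\<integral>y. \<iota> y \<partial>M)"
      using H[OF g] K unfolding pair ng I by (simp add: ennreal_mult[symmetric])
    then have "(\<integral>y. \<phi> y - K * \<iota> y \<partial>M) \<le> 0" using int by simp
    moreover have nn: "0 \<le> \<phi> y - K * \<iota> y" for y by (simp add: \<phi>_def \<iota>_def P_def)
    ultimately have "(\<integral>y. \<phi> y - K * \<iota> y \<partial>M) = 0"
      by (intro antisym Bochner_Integration.integral_nonneg) auto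
    then have "AE y in M. \<phi> y - K * \<iota> y = 0"
      using int nn by (subst (asm) integral_nonneg_eq_0_iff_AE) auto
    then show ?thesis by eventually_elim (auto simp: \<phi>_def \<iota>_def P_def split: if_splits)
  qed
  then have "AE y in M. \<forall>k. \<not> (K < norm (h y) \<and> norm (h y) \<le> real k)"
    unfolding AE_all_countable by blast
  then show ?thesis
    by eventually_elim (meson not_le real_arch_simple)
qed

text \<open>Bounding the sum by \<open>CARD('n)\<close> times its largest term treats exponents
  below and above \<open>1\<close> together.\<close>

lemma sum_powr_le:
  fixes a :: "'n::finite \<Rightarrow> real"
  assumes a: "\<And>j. 0 \<le> a j" and q: "0 \<le> q"
  shows "(\<Sum>j\<in>UNIV. a j) powr q \<le> real CARD('n) powr q * (\<Sum>j\<in>UNIV. a j powr q)"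
proof -
  have "Max (range a) \<in> range a" by (intro Max_in) auto
  then obtain m where "a m = Max (range a)" by (metis imageE)
  then have m: "a j \<le> a m" for j by simp
  have "(\<Sum>j\<in>UNIV. a j) \<le> real CARD('n) * a m"
    using sum_bounded_above[of UNIV a "a m"] m by simp
  then have "(\<Sum>j\<in>UNIV. a j) powr q \<le> (real CARD('n) * a m) powr q"
    using q a by (intro powr_mono2 sum_nonneg) auto
  also have "\<dots> = real CARD('n) powr q * a m powr q" using a by (simp add: powr_mult)
  also have "\<dots> \<le> real CARD('n) powr q * (\<Sum>j\<in>UNIV. a j powr q)"
    by (intro mult_left_mono member_le_sum) auto
  finally show ?thesis .
qed

subsection \<open>Necessity of the weight condition\<close>

lemma matrix_opnorm_powr_le_rows:
  fixes A :: "complex ^ 'n ^ 'n"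
  assumes "0 \<le> s"
  shows "matrix_opnorm A powr s \<le> real CARD('n) powr s * (\<Sum>i\<in>UNIV. norm (A $ i) powr s)"
proof -
  have "matrix_opnorm A powr s \<le> (\<Sum>i\<in>UNIV. norm (A $ i)) powr s"
    using assms by (intro powr_mono2 matrix_opnorm_le_rows matrix_opnorm_nonneg)
  also have "\<dots> \<le> real CARD('n) powr s * (\<Sum>i\<in>UNIV. norm (A $ i) powr s)"
    using assms by (intro sum_powr_le) auto
  finally show ?thesis .
qed

lemma matrix_opnorm_powr_le_columns:
  fixes A :: "complex ^ 'n ^ 'n"
  assumes "0 \<le> s"
  shows "matrix_opnorm A powr s \<le> real CARD('n) powr s * (\<Sum>j\<in>UNIV. norm (A *v axis j 1) powr s)"
proof -
  have "matrix_opnorm A powr s \<le> (\<Sum>j\<in>UNIV. norm (A *v axis j 1)) powr s"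
    using assms by (intro powr_mono2 matrix_opnorm_le_columns matrix_opnorm_nonneg)
  also have "\<dots> \<le> real CARD('n) powr s * (\<Sum>j\<in>UNIV. norm (A *v axis j 1) powr s)"
    using assms by (intro sum_powr_le) auto
  finally show ?thesis .
qed

text \<open>The hypothesis on averages without normalisation, over an abstract measure space.
  Integrability is demanded explicitly, since otherwise the inequality would hold trivially for
  non-integrable \<open>f\<close>.\<close>

definition avg_bound ::
    "'x measure \<Rightarrow> real \<Rightarrow> real \<Rightarrow> ('x \<Rightarrow> complex ^ 'n ^ 'n) \<Rightarrow> ('x \<Rightarrow> complex ^ 'n ^ 'n) \<Rightarrow> real \<Rightarrow> bool" where
  "avg_bound M p q X Z K \<longleftrightarrow> (\<forall>f \<in> borel_measurable M.
     (\<integral>\<^sup>+ y. ennreal (norm (Z y *v f y) powr p) \<partial>M) < \<infinity> \<longrightarrow>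
     integrable M f \<and>
     epowr (\<integral>\<^sup>+ x. ennreal (norm (X x *v (\<integral>y. f y \<partial>M)) powr q) \<partial>M) (1 / q)
       \<le> ennreal K * epowr (\<integral>\<^sup>+ y. ennreal (norm (Z y *v f y) powr p) \<partial>M) (1 / p))"

text \<open>Checks the requirements of \<open>auerbach_basis\<close> for \<open>N\<close>: the
  integrable majorant \<open>H\<close> makes \<open>N\<close> finite and, by dominated convergence,
  continuous, while almost everywhere invertibility of \<open>X\<close> on a space of nonzero
  measure makes it definite.\<close>

lemma reducing_matrix:
  fixes X :: "'x \<Rightarrow> complex ^ 'n ^ 'n"
  assumes X[measurable]: "X \<in> borel_measurable M"
    and inv: "AE x in M. \<exists>L. L ** X x = mat 1"
    and H: "integrable M H" "AE x in M. \<forall>v. norm (X x *v v) powr q \<le> H x * norm v powr q"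
    and M: "emeasure M (space M) \<noteq> 0" and q: "0 < q"
  obtains B T :: "complex ^ 'n ^ 'n" where "B ** T = mat 1"
    "(\<integral>\<^sup>+ x. ennreal (matrix_opnorm (X x ** B) powr q) \<partial>M) \<le> ennreal (real CARD('n) powr (q + 1))"
    "\<forall>v i. ennreal (cmod ((T *v v) $ i)) \<le> epowr (\<integral>\<^sup>+ x. ennreal (norm (X x *v v) powr q) \<partial>M) (1 / q)"
proof -
  have int: "integrable M (\<lambda>x. norm (X x *v v) powr q)" for v
  proof (rule Bochner_Integration.integrable_bound)
    show "integrable M (\<lambda>x. H x * norm v powr q)" using H(1) by simp
    show "AE x in M. norm (norm (X x *v v) powr q) \<le> norm (H x * norm v powr q)"
      using H(2) by eventually_elim (auto intro: order_trans[OF _ abs_ge_self])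
  qed measurable
  define I where "I v = (\<integral>x. norm (X x *v v) powr q \<partial>M)" for v
  have nnI: "(\<integral>\<^sup>+ x. ennreal (norm (X x *v v) powr q) \<partial>M) = ennreal (I v)" for v
    unfolding I_def by (intro nn_integral_eq_integral int) simp
  have I0: "0 \<le> I v" for v unfolding I_def by (rule Bochner_Integration.integral_nonneg) simp
  define N where "N v = I v powr (1 / q)" for v
  have contI: "continuous_on UNIV I"
    unfolding continuous_on_sequentially
  proof (intro allI ballI impI, elim conjE)
    fix u :: "nat \<Rightarrow> complex ^ 'n" and v assume u: "u \<longlonglongrightarrow> v"
    then obtain K where K: "\<And>k. norm (u k) \<le> K"
      using convergent_imp_Bseq[of u] by (auto simp: convergent_def Bseq_def)
    have "(\<lambda>k. \<integral>x. norm (X x *v u k) powr q \<partial>M) \<longlonglongrightarrow> (\<integral>x. norm (X x *v v) powr q \<partial>M)"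
    proof (rule integral_dominated_convergence)
      show "integrable M (\<lambda>x. H x * K powr q)" using H(1) by simp
      show "AE x in M. (\<lambda>k. norm (X x *v u k) powr q) \<longlonglongrightarrow> norm (X x *v v) powr q"
      proof (rule AE_I2)
        fix x
        have "(\<lambda>k. X x *v u k) \<longlonglongrightarrow> X x *v v"
          by (rule bounded_linear.tendsto[OF _ u]) simp
        then show "(\<lambda>k. norm (X x *v u k) powr q) \<longlonglongrightarrow> norm (X x *v v) powr q"
          using q by (intro tendsto_powr' tendsto_norm tendsto_const) auto
      qed
      show "AE x in M. norm (norm (X x *v u k) powr q) \<le> H x * K powr q" for k
        using H(2)
      proof eventually_elim
        fix x assume *: "\<forall>v. norm (X x *v v) powr q \<le> H x * norm v powr q"
        \<comment> \<open>Nonnegativity of \<open>H x\<close> follows by testing the majorant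
          property on a unit vector.\<close>
        have "0 \<le> H x"
          using order_trans[OF _ spec[OF *, of "axis undefined 1"]] by (simp add: norm_axis_eq)
        then have "H x * norm (u k) powr q \<le> H x * K powr q"
          using K[of k] q by (intro mult_left_mono powr_mono2) auto
        then show "norm (norm (X x *v u k) powr q) \<le> H x * K powr q"
          using spec[OF *, of "u k"] by simp
      qed
    qed measurable
    then show "(I \<circ> u) \<longlonglongrightarrow> I v" by (simp add: I_def comp_def)
  qed
  have contN: "continuous_on UNIV N"
    unfolding N_def using q by (intro continuous_on_powr' contI continuous_on_const) (auto simp: I0)
  have homN: "N (r *\<^sub>R v) = r * N v" if "0 \<le> r" for r v
  proof -
    have "X x *v (r *\<^sub>R v) = r *\<^sub>R (X x *v v)" for x by (simp add: linear_cmul)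
    then have "I (r *\<^sub>R v) = r powr q * I v"
      using that by (simp add: I_def powr_mult)
    then show ?thesis using that q I0 by (simp add: N_def powr_mult powr_powr)
  qed
  have posN: "0 < N v" if "v \<noteq> 0" for v
  proof (rule ccontr)
    assume "\<not> 0 < N v"
    then have "I v = 0" using I0[of v] by (simp add: N_def)
    then have "AE x in M. norm (X x *v v) powr q = 0"
      unfolding I_def by (subst (asm) integral_nonneg_eq_0_iff_AE[OF int]) auto
    with inv have "AE x in M. v = 0"
    proof eventually_elim
      fix x assume "\<exists>L. L ** X x = mat 1" and "norm (X x *v v) powr q = 0"
      then obtain L where "L ** X x = mat 1" "X x *v v = 0" by auto
      then show "v = 0" by (metis matrix_vector_mul_assoc matrix_vector_mul_lid matrix_vector_mult_0_right)
    qed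
    moreover have "ae_filter M \<noteq> bot" using M by (simp add: ae_filter_eq_bot_iff)
    ultimately show False using that eventually_const by blast
  qed
  obtain B T :: "complex ^ 'n ^ 'n" where BT: "B ** T = mat 1" and B: "\<forall>j. N (B *v axis j 1) \<le> 1"
    and T: "\<forall>v i. cmod ((T *v v) $ i) \<le> N v"
    by (rule auerbach_basis[OF contN homN posN])
  have IB: "I (B *v axis j 1) \<le> 1" for j
  proof -
    have "(I (B *v axis j 1) powr (1 / q)) powr q \<le> 1 powr q"
      using B q unfolding N_def by (intro powr_mono2) auto
    then show ?thesis using q I0 by (simp add: powr_powr)
  qed
  \<comment> \<open>The factor \<open>n powr q\<close> comes from \<open>sum_powr_le\<close>, and
    one further \<open>n\<close> from adding the column integrals, each at most
    \<open>1\<close>.\<close>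
  have "(\<integral>\<^sup>+ x. ennreal (matrix_opnorm (X x ** B) powr q) \<partial>M)
      \<le> (\<integral>\<^sup>+ x. ennreal (real CARD('n) powr q * (\<Sum>j\<in>UNIV. norm (X x *v (B *v axis j 1)) powr q)) \<partial>M)"
    using q matrix_opnorm_powr_le_columns[of q "X _ ** B"]
    by (intro nn_integral_mono ennreal_leI) (simp add: matrix_vector_mul_assoc)
  also have "\<dots> = ennreal (real CARD('n) powr q * (\<Sum>j\<in>UNIV. I (B *v axis j 1)))"
    unfolding I_def
    by (subst nn_integral_eq_integral)
      (auto intro!: int AE_I2 mult_nonneg_nonneg sum_nonneg simp: Bochner_Integration.integral_sum int)
  also have "\<dots> \<le> ennreal (real CARD('n) powr q * (\<Sum>j\<in>(UNIV :: 'n set). 1))"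
    by (intro ennreal_leI mult_left_mono sum_mono IB) auto
  also have "\<dots> = ennreal (real CARD('n) powr (q + 1))" by (simp add: powr_add)
  finally have "(\<integral>\<^sup>+ x. ennreal (matrix_opnorm (X x ** B) powr q) \<partial>M) \<le> ennreal (real CARD('n) powr (q + 1))" .
  moreover have "ennreal (cmod ((T *v v) $ i))
      \<le> epowr (\<integral>\<^sup>+ x. ennreal (norm (X x *v v) powr q) \<partial>M) (1 / q)" for v i
    unfolding nnI using T by (simp add: epowr_ennreal I0 N_def ennreal_leI)
  ultimately show ?thesis using that[OF BT] by blast
qed

text \<open>The test function is \<open>f = Y g\<close>, for which \<open>Z f = g\<close> almost
  everywhere. Coordinate \<open>i\<close> of \<open>T\<close> applied to the integral of
  \<open>f\<close> is the pairing of row \<open>i\<close> of \<open>T Y\<close> with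
  \<open>g\<close>, and \<open>T\<close> is dominated by \<open>N\<close>, to which
  \<open>avg\<close> applies.\<close>

lemma avg_bound_dual:
  fixes X Y Z :: "'x \<Rightarrow> complex ^ 'n ^ 'n"
  assumes [measurable]: "X \<in> borel_measurable M" "Y \<in> borel_measurable M" "Z \<in> borel_measurable M"
    and YZ: "AE y in M. Y y ** Z y = mat 1"
    and avg: "avg_bound M p q X Z K"
    and T: "\<forall>v i. ennreal (cmod ((T *v v) $ i)) \<le> epowr (\<integral>\<^sup>+ x. ennreal (norm (X x *v v) powr q) \<partial>M) (1 / q)"
    and g[measurable]: "g \<in> borel_measurable M" and fin: "(\<integral>\<^sup>+ y. ennreal (norm (g y) powr p) \<partial>M) < \<infinity>"
  shows "ennreal (cmod (\<integral>y. (\<Sum>j\<in>UNIV. ((T ** Y y) $ i) $ j * g y $ j) \<partial>M))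
    \<le> ennreal K * epowr (\<integral>\<^sup>+ y. ennreal (norm (g y) powr p) \<partial>M) (1 / p)"
proof -
  define f where "f y = Y y *v g y" for y
  have f[measurable]: "f \<in> borel_measurable M" unfolding f_def by measurable
  have "AE y in M. ennreal (norm (Z y *v f y) powr p) = ennreal (norm (g y) powr p)"
    using YZ
  proof eventually_elim
    fix y assume "Y y ** Z y = mat 1"
    then have "Z y ** Y y = mat 1" by (simp add: matrix_left_right_inverse)
    then show "ennreal (norm (Z y *v f y) powr p) = ennreal (norm (g y) powr p)"
      by (simp add: f_def matrix_vector_mul_assoc)
  qed
  then have eq: "(\<integral>\<^sup>+ y. ennreal (norm (Z y *v f y) powr p) \<partial>M) = (\<integral>\<^sup>+ y. ennreal (norm (g y) powr p) \<partial>M)"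
    by (rule nn_integral_cong_AE)
  have int: "integrable M f"
    and le: "epowr (\<integral>\<^sup>+ x. ennreal (norm (X x *v (\<integral>y. f y \<partial>M)) powr q) \<partial>M) (1 / q)
       \<le> ennreal K * epowr (\<integral>\<^sup>+ y. ennreal (norm (g y) powr p) \<partial>M) (1 / p)"
    using avg f fin unfolding avg_bound_def eq[symmetric] by blast+
  have "(T *v (\<integral>y. f y \<partial>M)) $ i = (\<integral>y. T *v f y \<partial>M) $ i"
    by (simp add: integral_matrix_vector_mult(2)[OF int])
  also have "\<dots> = (\<integral>y. (T *v f y) $ i \<partial>M)"
    by (rule integral_bounded_linear[OF bounded_linear_vec_nth integral_matrix_vector_mult(1)[OF int], symmetric])
  also have "\<dots> = (\<integral>y. (\<Sum>j\<in>UNIV. ((T ** Y y) $ i) $ j * g y $ j) \<partial>M)"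
    by (simp add: f_def matrix_vector_mul_assoc) (simp add: matrix_vector_mult_def)
  finally show ?thesis using order_trans[OF T[rule_format] le] by metis
qed

text \<open>In the constant, \<open>n powr (q + 1)\<close> belongs to \<open>X B\<close>. The factor
  \<open>n powr (p' + 1)\<close> comes from the rows of \<open>T Y\<close>: \<open>n powr p'\<close>
  from \<open>sum_powr_le\<close> and \<open>n\<close> from their number, with \<open>L^p'\<close>
  norms at most \<open>K\<close>.\<close>

lemma avg_bound_imp_Apq:
  fixes X Y Z :: "'x \<Rightarrow> complex ^ 'n ^ 'n"
  assumes fin: "finite_measure M" and meas[measurable]: "X \<in> borel_measurable M" "Y \<in> borel_measurable M" "Z \<in> borel_measurable M"
    and YZ: "AE y in M. Y y ** Z y = mat 1"
    and inv: "AE x in M. \<exists>L. L ** X x = mat 1"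
    and H: "integrable M H" "AE x in M. \<forall>v. norm (X x *v v) powr q \<le> H x * norm v powr q"
    and M: "emeasure M (space M) \<noteq> 0" and q: "0 < q"
    and p: "1 < p" "1 < p'" "1 / p' + 1 / p = 1" and K: "0 \<le> K"
    and avg: "avg_bound M p q X Z K"
  shows "(\<integral>\<^sup>+ x. epowr (\<integral>\<^sup>+ y. ennreal (matrix_opnorm (X x ** Y y) powr p') \<partial>M) (q / p') \<partial>M)
    \<le> ennreal (real CARD('n) powr (q + 1) * (real CARD('n) powr (p' + 1)) powr (q / p') * K powr q)"
proof -
  let ?n = "real CARD('n)"
  obtain B T :: "complex ^ 'n ^ 'n" where BT: "B ** T = mat 1"
    and B: "(\<integral>\<^sup>+ x. ennreal (matrix_opnorm (X x ** B) powr q) \<partial>M) \<le> ennreal (?n powr (q + 1))"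
    and T: "\<forall>v i. ennreal (cmod ((T *v v) $ i)) \<le> epowr (\<integral>\<^sup>+ x. ennreal (norm (X x *v v) powr q) \<partial>M) (1 / q)"
    by (rule reducing_matrix[OF meas(1) inv H M q])
  let ?D = "\<integral>\<^sup>+ y. ennreal (matrix_opnorm (T ** Y y) powr p') \<partial>M"
  have row: "(\<integral>\<^sup>+ y. ennreal (norm ((T ** Y y) $ i) powr p') \<partial>M) \<le> ennreal (K powr p')" for i
    by (rule Lp_norm_le_dual[OF fin _ p K]) (measurable, rule avg_bound_dual[OF meas YZ avg T])
  have "?D \<le> (\<integral>\<^sup>+ y. (\<Sum>i\<in>UNIV. ennreal (?n powr p') * ennreal (norm ((T ** Y y) $ i) powr p')) \<partial>M)"
    using p matrix_opnorm_powr_le_rows[of p' "T ** Y _"]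
    by (intro nn_integral_mono)
      (simp add: sum_distrib_left[symmetric] sum_ennreal ennreal_mult[symmetric] sum_nonneg ennreal_leI)
  also have "\<dots> = (\<Sum>i\<in>UNIV. ennreal (?n powr p') * (\<integral>\<^sup>+ y. ennreal (norm ((T ** Y y) $ i) powr p') \<partial>M))"
    by (simp add: nn_integral_sum nn_integral_cmult)
  also have "\<dots> \<le> (\<Sum>i\<in>(UNIV :: 'n set). ennreal (?n powr p') * ennreal (K powr p'))"
    by (intro sum_mono mult_left_mono row) auto
  also have "\<dots> = ennreal (?n powr (p' + 1) * K powr p')"
    by (simp add: ennreal_mult[symmetric] powr_add ennreal_of_nat_eq_real_of_nat mult_ac)
  finally have D: "?D \<le> ennreal (?n powr (p' + 1) * K powr p')" .
  have "(\<integral>\<^sup>+ x. epowr (\<integral>\<^sup>+ y. ennreal (matrix_opnorm (X x ** Y y) powr p') \<partial>M) (q / p') \<partial>M)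
      \<le> (\<integral>\<^sup>+ x. ennreal (matrix_opnorm (X x ** B) powr q) * epowr ?D (q / p') \<partial>M)"
  proof (rule nn_integral_mono)
    fix x
    have "(\<integral>\<^sup>+ y. ennreal (matrix_opnorm (X x ** Y y) powr p') \<partial>M)
        \<le> (\<integral>\<^sup>+ y. ennreal (matrix_opnorm (X x ** B) powr p') * ennreal (matrix_opnorm (T ** Y y) powr p') \<partial>M)"
    proof (rule nn_integral_mono)
      fix y
      have "X x ** Y y = (X x ** B) ** (T ** Y y)"
        using BT by (metis matrix_mul_assoc matrix_mul_rid)
      then have "matrix_opnorm (X x ** Y y) powr p' \<le> (matrix_opnorm (X x ** B) * matrix_opnorm (T ** Y y)) powr p'"
        using p by (intro powr_mono2) (auto simp: matrix_opnorm_nonneg matrix_opnorm_mult)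
      then show "ennreal (matrix_opnorm (X x ** Y y) powr p')
          \<le> ennreal (matrix_opnorm (X x ** B) powr p') * ennreal (matrix_opnorm (T ** Y y) powr p')"
        by (simp add: ennreal_mult[symmetric] powr_mult matrix_opnorm_nonneg ennreal_leI)
    qed
    also have "\<dots> = ennreal (matrix_opnorm (X x ** B) powr p') * ?D"
      by (rule nn_integral_cmult) measurable
    finally have "epowr (\<integral>\<^sup>+ y. ennreal (matrix_opnorm (X x ** Y y) powr p') \<partial>M) (q / p')
        \<le> epowr (ennreal (matrix_opnorm (X x ** B) powr p') * ?D) (q / p')"
      using p q by (intro epowr_mono) auto
    then show "epowr (\<integral>\<^sup>+ y. ennreal (matrix_opnorm (X x ** Y y) powr p') \<partial>M) (q / p')
        \<le> ennreal (matrix_opnorm (X x ** B) powr q) * epowr ?D (q / p')"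
      using p by (simp add: epowr_mult epowr_ennreal powr_powr)
  qed
  also have "\<dots> = (\<integral>\<^sup>+ x. ennreal (matrix_opnorm (X x ** B) powr q) \<partial>M) * epowr ?D (q / p')"
    by (rule nn_integral_multc) measurable
  also have "\<dots> \<le> ennreal (?n powr (q + 1)) * epowr (ennreal (?n powr (p' + 1) * K powr p')) (q / p')"
    using p q by (intro mult_mono B epowr_mono D) auto
  also have "\<dots> = ennreal (?n powr (q + 1) * (?n powr (p' + 1)) powr (q / p') * K powr q)"
    using p by (simp add: epowr_ennreal ennreal_mult[symmetric] powr_mult powr_powr mult.assoc)
  finally show ?thesis .
qed

text \<open>For \<open>p = 1\<close> duality bounds the rows of \<open>T Y\<close> almost everywhere
  by \<open>K\<close>. Their sum gives the operator norm bound \<open>n * K\<close> and thus the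
  second factor \<open>n powr q\<close>.\<close>

lemma avg_bound_imp_A1q:
  fixes X Y Z :: "'x \<Rightarrow> complex ^ 'n ^ 'n"
  assumes fin: "finite_measure M" and meas[measurable]: "X \<in> borel_measurable M" "Y \<in> borel_measurable M" "Z \<in> borel_measurable M"
    and YZ: "AE y in M. Y y ** Z y = mat 1"
    and inv: "AE x in M. \<exists>L. L ** X x = mat 1"
    and H: "integrable M H" "AE x in M. \<forall>v. norm (X x *v v) powr q \<le> H x * norm v powr q"
    and M: "emeasure M (space M) \<noteq> 0" and q: "0 < q" and K: "0 \<le> K"
    and avg: "avg_bound M 1 q X Z K"
  shows "AE y in M. (\<integral>\<^sup>+ x. ennreal (matrix_opnorm (X x ** Y y) powr q) \<partial>M)
    \<le> ennreal (real CARD('n) powr (q + 1) * real CARD('n) powr q * K powr q)"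
proof -
  let ?n = "real CARD('n)"
  obtain B T :: "complex ^ 'n ^ 'n" where BT: "B ** T = mat 1"
    and B: "(\<integral>\<^sup>+ x. ennreal (matrix_opnorm (X x ** B) powr q) \<partial>M) \<le> ennreal (?n powr (q + 1))"
    and T: "\<forall>v i. ennreal (cmod ((T *v v) $ i)) \<le> epowr (\<integral>\<^sup>+ x. ennreal (norm (X x *v v) powr q) \<partial>M) (1 / q)"
    by (rule reducing_matrix[OF meas(1) inv H M q])
  have "AE y in M. norm ((T ** Y y) $ i) \<le> K" for i
  proof (rule AE_norm_le_dual[OF fin _ K])
    fix g :: "'x \<Rightarrow> complex ^ 'n"
    assume g: "g \<in> borel_measurable M" "(\<integral>\<^sup>+ y. ennreal (norm (g y)) \<partial>M) < \<infinity>"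
    show "ennreal (cmod (\<integral>y. (\<Sum>j\<in>UNIV. (T ** Y y) $ i $ j * g y $ j) \<partial>M))
        \<le> ennreal K * (\<integral>\<^sup>+ y. ennreal (norm (g y)) \<partial>M)"
      using avg_bound_dual[OF meas YZ avg T g(1)] g(2) by (simp add: epowr_1)
  qed measurable
  then have "AE y in M. \<forall>i. norm ((T ** Y y) $ i) \<le> K"
    unfolding AE_all_countable by blast
  then show ?thesis
  proof eventually_elim
    fix y assume "\<forall>i. norm ((T ** Y y) $ i) \<le> K"
    then have "matrix_opnorm (T ** Y y) \<le> (\<Sum>i\<in>(UNIV :: 'n set). K)"
      by (intro order_trans[OF matrix_opnorm_le_rows] sum_mono) auto
    then have TY: "matrix_opnorm (T ** Y y) powr q \<le> ?n powr q * K powr q"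
      using q K powr_mono2[of q "matrix_opnorm (T ** Y y)" "?n * K"]
      by (simp add: matrix_opnorm_nonneg powr_mult)
    have "(\<integral>\<^sup>+ x. ennreal (matrix_opnorm (X x ** Y y) powr q) \<partial>M)
        \<le> (\<integral>\<^sup>+ x. ennreal (matrix_opnorm (X x ** B) powr q) * ennreal (?n powr q * K powr q) \<partial>M)"
    proof (rule nn_integral_mono)
      fix x
      have "X x ** Y y = (X x ** B) ** (T ** Y y)"
        using BT by (metis matrix_mul_assoc matrix_mul_rid)
      then have "matrix_opnorm (X x ** Y y) powr q \<le> (matrix_opnorm (X x ** B) * matrix_opnorm (T ** Y y)) powr q"
        using q by (intro powr_mono2) (auto simp: matrix_opnorm_nonneg matrix_opnorm_mult)
      also have "\<dots> = matrix_opnorm (X x ** B) powr q * matrix_opnorm (T ** Y y) powr q"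
        by (simp add: powr_mult matrix_opnorm_nonneg)
      also have "\<dots> \<le> matrix_opnorm (X x ** B) powr q * (?n powr q * K powr q)"
        by (intro mult_left_mono TY) simp
      finally show "ennreal (matrix_opnorm (X x ** Y y) powr q)
          \<le> ennreal (matrix_opnorm (X x ** B) powr q) * ennreal (?n powr q * K powr q)"
        by (simp add: ennreal_mult[symmetric] ennreal_leI)
    qed
    also have "\<dots> = (\<integral>\<^sup>+ x. ennreal (matrix_opnorm (X x ** B) powr q) \<partial>M) * ennreal (?n powr q * K powr q)"
      by (rule nn_integral_multc) measurable
    also have "\<dots> \<le> ennreal (?n powr (q + 1)) * ennreal (?n powr q * K powr q)"
      by (intro mult_right_mono B) simp
    finally show "(\<integral>\<^sup>+ x. ennreal (matrix_opnorm (X x ** Y y) powr q) \<partial>M)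
        \<le> ennreal (?n powr (q + 1) * ?n powr q * K powr q)"
      by (simp add: ennreal_mult[symmetric] mult.assoc)
  qed
qed

subsection \<open>Cubes and matrix weights\<close>

lemma cube_lmeasurable: "cube c l \<in> lmeasurable"
  by (simp add: cube_def)

lemma measure_cube_pos: "0 < l \<Longrightarrow> 0 < measure lebesgue (cube (c :: real ^ 'a) l)"
proof -
  assume l: "0 < l"
  let ?a = "\<chi> i. c $ i - l / 2" and ?b = "\<chi> i. c $ i + l / 2"
  have "cbox ?a ?b \<noteq> {}"
    using l by (auto simp: interval_ne_empty_cart)
  then have "measure lborel (cbox ?a ?b) = (\<Prod>i\<in>(UNIV :: 'a set). l)"
    by (simp add: content_cbox_cart)
  then show ?thesis using l by (simp add: cube_def)
qed

lemma psi_vol_pos: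
  assumes "critical_radius \<rho>" "0 < l"
  shows "0 < psi_vol \<rho> \<theta> c l"
proof -
  have "0 < \<rho> c" using assms(1) by (simp add: critical_radius_def)
  then have "0 < 1 + l / \<rho> c" using assms(2) by (simp add: add_pos_pos)
  then show ?thesis using measure_cube_pos[OF assms(2), of c] by (simp add: psi_vol_def psi_def)
qed

lemma nn_integral_cube:
  "(\<integral>\<^sup>+ x. f x \<partial>lebesgue_on (cube c l)) = (\<integral>\<^sup>+ x \<in> cube c l. f x \<partial>lebesgue)"
  using cube_lmeasurable[of c l] by (intro nn_integral_restrict_space) (simp add: fmeasurableD)

lemma finite_measure_cube: "finite_measure (lebesgue_on (cube c l))"
  using cube_lmeasurable by (rule finite_measure_lebesgue_on)

lemma emeasure_cube_neq_0:
  assumes "0 < l"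
  shows "emeasure (lebesgue_on (cube c l)) (space (lebesgue_on (cube c l))) \<noteq> 0"
proof -
  have "emeasure (lebesgue_on (cube c l)) (space (lebesgue_on (cube c l))) = emeasure lebesgue (cube c l)"
    using cube_lmeasurable[of c l] by (simp add: emeasure_restrict_space fmeasurableD)
  then show ?thesis
    using measure_cube_pos[OF assms, of c] by (auto simp: measure_def)
qed

lemma AE_cube:
  assumes "AE x in lebesgue. P x"
  shows "AE x in lebesgue_on (cube c l). P x"
  using assms cube_lmeasurable[of c l]
  by (subst AE_restrict_space_iff) (auto simp: fmeasurableD elim: eventually_mono)

text \<open>Applied to \<open>V\<close> this is \<open>Y Z = 1\<close>; applied to \<open>U\<close>
  it supplies the left inverses of \<open>X\<close>.\<close>

lemma weight_AE_inverse:
  assumes "matrix_weight W"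
  shows "AE x in lebesgue. mpowr (W x) (- 1 / q) ** mpowr (W x) (1 / q) = mat 1"
proof -
  have "AE x in lebesgue. pos_definite (W x)" using assms by (simp add: matrix_weight_def)
  then show ?thesis
  proof eventually_elim
    fix x assume "pos_definite (W x)"
    from mpowr_minus_mult[OF this, of "1 / q"]
    show "mpowr (W x) (- 1 / q) ** mpowr (W x) (1 / q) = mat 1" by simp
  qed
qed

text \<open>The majorant is the sum of the moduli of the entries of \<open>W\<close>, integrable on
  cubes by the definition of a weight and at least the operator norm of \<open>W x\<close>.\<close>

lemma weight_dominated:
  fixes W :: "real ^ 'd \<Rightarrow> complex ^ 'n ^ 'n"
  assumes W: "matrix_weight W" and q: "0 < q"
  obtains H where "integrable (lebesgue_on (cube c l)) H"
    "AE x in lebesgue_on (cube c l). \<forall>v. norm (mpowr (W x) (1 / q) *v v) powr q \<le> H x * norm v powr q"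
proof -
  define H where "H x = (\<Sum>i\<in>UNIV. \<Sum>j\<in>UNIV. cmod (W x $ i $ j))" for x
  have "integrable (lebesgue_on (cube c l)) (\<lambda>x. W x $ i $ j)" for i j
  proof -
    have "compact (cube c l)" by (simp add: cube_def)
    then have "set_integrable lebesgue (cube c l) (\<lambda>x. W x $ i $ j)"
      using W by (simp add: matrix_weight_def)
    then show ?thesis
      using cube_lmeasurable[of c l] by (simp add: integrable_restrict_space set_integrable_def fmeasurableD)
  qed
  then have "integrable (lebesgue_on (cube c l)) H"
    unfolding H_def by (intro Bochner_Integration.integrable_sum integrable_norm)
  moreover have "AE x in lebesgue_on (cube c l). pos_definite (W x)"
    using W by (intro AE_cube) (simp add: matrix_weight_def)
  then have "AE x in lebesgue_on (cube c l). \<forall>v. norm (mpowr (W x) (1 / q) *v v) powr q \<le> H x * norm v powr q"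
  proof eventually_elim
    fix x assume "pos_definite (W x)"
    then show "\<forall>v. norm (mpowr (W x) (1 / q) *v v) powr q \<le> H x * norm v powr q"
      unfolding H_def using norm_mpowr_vec_le[OF _ q] matrix_opnorm_le_entries[of "W x"]
      by (meson mult_right_mono order_trans powr_ge_zero)
  qed
  ultimately show ?thesis by (rule that)
qed

lemma weighted_norm_mpowr:
  assumes V: "matrix_weight V" and p: "0 < p"
  shows "weighted_norm p (\<lambda>x. mpowr (V x) (p / q)) f
    = epowr (\<integral>\<^sup>+ x. ennreal (norm (mpowr (V x) (1 / q) *v f x) powr p) \<partial>lebesgue) (1 / p)"
proof -
  have "AE x in lebesgue. pos_definite (V x)" using V by (simp add: matrix_weight_def)
  then have "AE x in lebesgue. ennreal (norm (mpowr (mpowr (V x) (p / q)) (1 / p) *v f x) powr p)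
      = ennreal (norm (mpowr (V x) (1 / q) *v f x) powr p)"
    by eventually_elim (use p in \<open>simp add: mpowr_mpowr\<close>)
  then show ?thesis unfolding weighted_norm_def by (subst nn_integral_cong_AE) auto
qed

lemma integral_cube:
  fixes f :: "real ^ 'd \<Rightarrow> complex ^ 'n"
  shows "set_lebesgue_integral lebesgue (cube c l) f = (\<integral>x. f x \<partial>lebesgue_on (cube c l))"
    and "set_integrable lebesgue (cube c l) f \<longleftrightarrow> integrable (lebesgue_on (cube c l)) f"
proof -
  have Q: "cube c l \<inter> space lebesgue \<in> sets lebesgue" using fmeasurableD[OF cube_lmeasurable] by simp
  show "set_lebesgue_integral lebesgue (cube c l) f = (\<integral>x. f x \<partial>lebesgue_on (cube c l))"
    unfolding set_lebesgue_integral_def integral_restrict_space[OF Q] ..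
  show "set_integrable lebesgue (cube c l) f \<longleftrightarrow> integrable (lebesgue_on (cube c l)) f"
    unfolding set_integrable_def integrable_restrict_space[OF Q] ..
qed

section \<open>Averages over cubes: sufficiency of the weight condition\<close>

lemma weighted_norm_averaging_op:
  fixes f :: "real ^ 'd \<Rightarrow> complex ^ 'n"
  assumes \<rho>: "critical_radius \<rho>" and l: "0 < l" and q: "0 < q" and U: "matrix_weight U"
  shows "weighted_norm q U (averaging_op \<rho> \<alpha> \<theta> c l f)
    = ennreal (psi_vol \<rho> \<theta> c l powr (- (1 - \<alpha> / real CARD('d)))) *
      epowr (\<integral>\<^sup>+ x. ennreal (norm (mpowr (U x) (1 / q) *v (\<integral>y. f y \<partial>lebesgue_on (cube c l))) powr q)
        \<partial>lebesgue_on (cube c l)) (1 / q)"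
proof -
  let ?Q = "cube c l" and ?X = "\<lambda>x. mpowr (U x) (1 / q)"
  define I where "I = (\<integral>y. f y \<partial>lebesgue_on ?Q)"
  define k where "k = psi_vol \<rho> \<theta> c l powr (- (1 - \<alpha> / real CARD('d)))"
  have k: "0 \<le> k" by (simp add: k_def)
  have [measurable]: "?X \<in> borel_measurable lebesgue" by (rule mpowr_weight_measurable[OF U])
  have [measurable]: "?Q \<in> sets lebesgue" using cube_lmeasurable by (rule fmeasurableD)
  have op: "averaging_op \<rho> \<alpha> \<theta> c l f x = indicator ?Q x *\<^sub>R (k *\<^sub>R I)" for x
    unfolding averaging_op_def k_def I_def integral_cube by (simp only: powr_minus inverse_eq_divide)
  have lin: "?X x *v (r *\<^sub>R v) = r *\<^sub>R (?X x *v v)" for x r and v :: "complex ^ 'n"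
    by (simp add: linear_cmul)
  have "ennreal (norm (?X x *v (indicator ?Q x *\<^sub>R (k *\<^sub>R I))) powr q)
      = ennreal (k powr q) * (ennreal (norm (?X x *v I) powr q) * indicator ?Q x)" for x
    using k q by (cases "x \<in> ?Q") (simp_all add: lin powr_mult ennreal_mult)
  then have "weighted_norm q U (averaging_op \<rho> \<alpha> \<theta> c l f)
      = epowr (\<integral>\<^sup>+ x. ennreal (k powr q) * (ennreal (norm (?X x *v I) powr q) * indicator ?Q x) \<partial>lebesgue) (1 / q)"
    unfolding weighted_norm_def op by simp
  also have "\<dots> = epowr (ennreal (k powr q) * (\<integral>\<^sup>+ x \<in> ?Q. ennreal (norm (?X x *v I) powr q) \<partial>lebesgue)) (1 / q)"
    by (subst nn_integral_cmult) measurable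
  also have "\<dots> = ennreal k * epowr (\<integral>\<^sup>+ x. ennreal (norm (?X x *v I) powr q) \<partial>lebesgue_on ?Q) (1 / q)"
    using k q by (simp add: epowr_mult epowr_ennreal powr_powr nn_integral_cube)
  finally show ?thesis by (simp add: k_def I_def)
qed

lemma kernel_bound_le_Apq:
  fixes U V :: "real ^ 'd \<Rightarrow> complex ^ 'n ^ 'n"
  assumes \<rho>: "critical_radius \<rho>" and p: "1 \<le> p" and pq: "p \<le> q"
    and \<alpha>: "1 / p - 1 / q = \<alpha> / real CARD('d)"
    and U: "matrix_weight U" and V: "matrix_weight V" and l: "0 < l"
    and f: "f \<in> borel_measurable (lebesgue_on (cube c l))"
  shows "kernel_bound (lebesgue_on (cube c l)) q
      (\<lambda>x. mpowr (U x) (1 / q)) (\<lambda>y. mpowr (V y) (- 1 / q)) (\<lambda>y. mpowr (V y) (1 / q)) f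
    \<le> ennreal (psi_vol \<rho> \<theta> c l powr (q * (1 - \<alpha> / real CARD('d)))) * Apq_const \<rho> \<theta> p q U V *
      epowr (\<integral>\<^sup>+ y. ennreal (norm (mpowr (V y) (1 / q) *v f y) powr p) \<partial>lebesgue_on (cube c l)) (q / p)"
proof -
  define M where "M = lebesgue_on (cube c l)"
  define X where "X x = mpowr (U x) (1 / q)" for x
  define Y where "Y y = mpowr (V y) (- 1 / q)" for y
  define Z where "Z y = mpowr (V y) (1 / q)" for y
  define a where "a = psi_vol \<rho> \<theta> c l"
  define A where "A = Apq_const \<rho> \<theta> p q U V"
  have a: "0 < a" unfolding a_def by (rule psi_vol_pos[OF \<rho> l])
  have q: "1 \<le> q" using p pq by simp
  have meas: "X \<in> borel_measurable M" "Y \<in> borel_measurable M" "Z \<in> borel_measurable M"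
    unfolding X_def[abs_def] Y_def[abs_def] Z_def[abs_def] M_def
    by (intro measurable_restrict_space1 mpowr_weight_measurable U V)+
  note [measurable] = meas
  interpret M: finite_measure M unfolding M_def by (rule finite_measure_cube)
  have sf: "sigma_finite_measure M" by (rule M.sigma_finite_measure_axioms)
  have f: "f \<in> borel_measurable M" using f by (simp add: M_def)
  have MI: "(\<integral>\<^sup>+ x \<in> cube c l. g x \<partial>lebesgue) = (\<integral>\<^sup>+ x. g x \<partial>M)" for g
    unfolding M_def nn_integral_cube ..
  \<comment> \<open>Moves a positive finite factor across an inequality in \<open>ennreal\<close>,
    where both \<open>x\<close> and \<open>A\<close> may be infinite.\<close>
  have inv: "x \<le> ennreal b * A" if le: "ennreal (1 / b) * x \<le> A" and b: "0 < b" for x b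
  proof -
    have "ennreal b * (ennreal (1 / b) * x) = x"
      using b by (simp add: mult.assoc[symmetric] ennreal_mult[symmetric])
    then show ?thesis using mult_left_mono[OF le, of "ennreal b"] by simp
  qed
  have "kernel_bound M q X Y Z f \<le> ennreal (a powr (q * (1 - \<alpha> / real CARD('d)))) * A *
      epowr (\<integral>\<^sup>+ y. ennreal (norm (Z y *v f y) powr p) \<partial>M) (q / p)"
  proof (cases "p = 1")
    case True
    have exp: "q * (1 - \<alpha> / real CARD('d)) = 1"
      using \<alpha>[symmetric] True q by (simp add: field_simps)
    have "esssup (restrict_space lebesgue (cube c l)) (\<lambda>y. ennreal (1 / psi_vol \<rho> \<theta> c l) *
        (\<integral>\<^sup>+ x \<in> cube c l. ennreal (matrix_opnorm (mpowr (U x) (1 / q) ** mpowr (V y) (- 1 / q)) powr q)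
          \<partial>lebesgue)) \<le> A"
      unfolding A_def Apq_const_def using True l by (auto intro!: SUP_upper2[of "(c, l)"])
    then have ess: "esssup M (\<lambda>y. ennreal (1 / a) * (\<integral>\<^sup>+ x. ennreal (matrix_opnorm (X x ** Y y) powr q) \<partial>M)) \<le> A"
      unfolding MI a_def[symmetric] X_def[symmetric] Y_def[symmetric] M_def[symmetric] .
    have "AE y in M. ennreal (1 / a) * (\<integral>\<^sup>+ x. ennreal (matrix_opnorm (X x ** Y y) powr q) \<partial>M)
        \<le> esssup M (\<lambda>y. ennreal (1 / a) * (\<integral>\<^sup>+ x. ennreal (matrix_opnorm (X x ** Y y) powr q) \<partial>M))"
      by (rule esssup_AE)
    then have "AE y in M. (\<integral>\<^sup>+ x. ennreal (matrix_opnorm (X x ** Y y) powr q) \<partial>M) \<le> ennreal a * A"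
      by eventually_elim (intro inv a order_trans[OF _ ess])
    from kernel_bound_jensen[OF sf f meas q this]
    show ?thesis using True a by (simp add: exp)
  next
    case False
    then have p1: "1 < p" using p by simp
    define p' where "p' = p / (p - 1)"
    have p': "1 < p'" "1 / p' + 1 / p = 1" using p1 by (simp_all add: p'_def field_simps)
    define e where "e = 1 + q / p'"
    \<comment> \<open>The scaling relation makes the exponent of \<open>psi_vol\<close> match the
      two normalisations in the weight condition: the outer one contributes \<open>1\<close>, the
      inner one \<open>q / p'\<close>.\<close>
    have exp: "q * (1 - \<alpha> / real CARD('d)) = e"
    proof -
      have "q * (1 - \<alpha> / real CARD('d)) = q * (1 / p' + 1 / q)"
        using \<alpha> p'(2) by simp
      also have "\<dots> = e" using q by (simp add: e_def distrib_left)
      finally show ?thesis .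
    qed
    let ?J = "\<integral>\<^sup>+ x. epowr (\<integral>\<^sup>+ y. ennreal (matrix_opnorm (X x ** Y y) powr p') \<partial>M) (q / p') \<partial>M"
    have "ennreal (1 / psi_vol \<rho> \<theta> c l) * (\<integral>\<^sup>+ x \<in> cube c l. epowr (ennreal (1 / psi_vol \<rho> \<theta> c l) *
         (\<integral>\<^sup>+ y \<in> cube c l. ennreal (matrix_opnorm (mpowr (U x) (1 / q) ** mpowr (V y) (- 1 / q)) powr p')
                 \<partial>lebesgue)) (q / p') \<partial>lebesgue) \<le> A"
      unfolding A_def Apq_const_def p'_def Let_def if_not_P[OF False]
      using l by (intro SUP_upper2[of "(c, l)"]) auto
    then have "ennreal (1 / a) * (\<integral>\<^sup>+ x. epowr (ennreal (1 / a) *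
         (\<integral>\<^sup>+ y. ennreal (matrix_opnorm (X x ** Y y) powr p') \<partial>M)) (q / p') \<partial>M) \<le> A"
      unfolding MI a_def[symmetric] X_def[symmetric] Y_def[symmetric] M_def[symmetric] .
    moreover have "(\<integral>\<^sup>+ x. epowr (ennreal (1 / a) *
         (\<integral>\<^sup>+ y. ennreal (matrix_opnorm (X x ** Y y) powr p') \<partial>M)) (q / p') \<partial>M)
        = ennreal ((1 / a) powr (q / p')) * ?J"
      using a by (simp add: epowr_mult epowr_ennreal nn_integral_cmult)
    moreover have "ennreal (1 / a) * ennreal ((1 / a) powr (q / p')) = ennreal (1 / (a powr e))"
      using a by (simp add: e_def ennreal_mult[symmetric] powr_add powr_divide)
    ultimately have "ennreal (1 / (a powr e)) * ?J \<le> A" by (simp add: mult.assoc[symmetric])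
    then have "?J \<le> ennreal (a powr e) * A" using a by (intro inv) auto
    then have "?J * epowr (\<integral>\<^sup>+ y. ennreal (norm (Z y *v f y) powr p) \<partial>M) (q / p)
        \<le> ennreal (a powr e) * A * epowr (\<integral>\<^sup>+ y. ennreal (norm (Z y *v f y) powr p) \<partial>M) (q / p)"
      by (rule mult_right_mono) simp
    moreover have "kernel_bound M q X Y Z f \<le> ?J * epowr (\<integral>\<^sup>+ y. ennreal (norm (Z y *v f y) powr p) \<partial>M) (q / p)"
      using q by (intro kernel_bound_holder sf f meas p1 p') simp
    ultimately show ?thesis unfolding exp by (rule order_trans[rotated])
  qed
  then show ?thesis
    unfolding X_def[abs_def] Y_def[abs_def] Z_def[abs_def] M_def A_def a_def .
qed

lemma nn_integral_cube_le: "(\<integral>\<^sup>+ x. f x \<partial>lebesgue_on (cube c l)) \<le> (\<integral>\<^sup>+ x. f x \<partial>lebesgue)"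
  unfolding nn_integral_cube by (intro nn_integral_mono) (simp add: indicator_def)

text \<open>After taking the \<open>q\<close>-th root, the power of \<open>psi_vol\<close> in the
  kernel bound is the reciprocal of the normalisation of the operator, so the constant is
  \<open>1\<close>. If the weight constant is finite, so is the kernel bound, and integrability
  follows from it.\<close>

lemma averaging_op_bound:
  fixes U V :: "real ^ 'd \<Rightarrow> complex ^ 'n ^ 'n"
  assumes \<rho>: "critical_radius \<rho>" and p: "1 \<le> p" and pq: "p \<le> q"
    and \<alpha>: "1 / p - 1 / q = \<alpha> / real CARD('d)"
    and U: "matrix_weight U" and V: "matrix_weight V" and l: "0 < l"
    and f: "f \<in> weighted_space p (\<lambda>x. mpowr (V x) (p / q))"
  shows "weighted_norm q U (averaging_op \<rho> \<alpha> \<theta> c l f)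
      \<le> epowr (Apq_const \<rho> \<theta> p q U V) (1 / q) * weighted_norm p (\<lambda>x. mpowr (V x) (p / q)) f"
    and "Apq_const \<rho> \<theta> p q U V < \<infinity> \<Longrightarrow> set_integrable lebesgue (cube c l) f"
proof -
  let ?M = "lebesgue_on (cube c l)"
  let ?X = "\<lambda>x. mpowr (U x) (1 / q)" and ?Y = "\<lambda>y. mpowr (V y) (- 1 / q)" and ?Z = "\<lambda>y. mpowr (V y) (1 / q)"
  let ?a = "psi_vol \<rho> \<theta> c l" and ?A = "Apq_const \<rho> \<theta> p q U V"
  let ?e = "1 - \<alpha> / real CARD('d)"
  let ?N = "\<integral>\<^sup>+ y. ennreal (norm (?Z y *v f y) powr p) \<partial>lebesgue"
  have a: "0 < ?a" by (rule psi_vol_pos[OF \<rho> l])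
  have q: "1 \<le> q" using p pq by simp
  have wn: "weighted_norm p (\<lambda>x. mpowr (V x) (p / q)) f = epowr ?N (1 / p)"
    using p by (intro weighted_norm_mpowr V) simp
  have fm: "f \<in> borel_measurable ?M"
    using f by (intro measurable_restrict_space1) (simp add: weighted_space_def)
  have meas: "?X \<in> borel_measurable ?M" "?Y \<in> borel_measurable ?M" "?Z \<in> borel_measurable ?M"
    by (intro measurable_restrict_space1 mpowr_weight_measurable U V)+
  have YZ: "AE y in ?M. ?Y y ** ?Z y = mat 1" by (intro AE_cube weight_AE_inverse V)
  have XX: "AE x in ?M. \<exists>L. L ** ?X x = mat 1"
    using AE_cube[OF weight_AE_inverse[OF U]] by (rule eventually_mono) blast
  have kb: "kernel_bound ?M q ?X ?Y ?Z f \<le> ennreal (?a powr (q * ?e)) * ?A * epowr ?N (q / p)"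
    by (rule order_trans[OF kernel_bound_le_Apq[OF \<rho> p pq \<alpha> U V l fm, where \<theta> = \<theta>]])
      (use p q in \<open>intro mult_left_mono epowr_mono nn_integral_cube_le; simp\<close>)
  have "epowr (\<integral>\<^sup>+ x. ennreal (norm (?X x *v (\<integral>y. f y \<partial>?M)) powr q) \<partial>?M) (1 / q)
      \<le> epowr (ennreal (?a powr (q * ?e)) * ?A * epowr ?N (q / p)) (1 / q)"
    using q by (intro epowr_mono order_trans[OF averaging_norm_le_kernel_bound[OF fm YZ] kb]) auto
  also have "\<dots> = ennreal (?a powr ?e) * (epowr ?A (1 / q) * epowr ?N (1 / p))"
    using q a by (simp add: epowr_mult epowr_epowr epowr_ennreal powr_powr mult.assoc)
  finally have "ennreal (?a powr (- ?e)) *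
      epowr (\<integral>\<^sup>+ x. ennreal (norm (?X x *v (\<integral>y. f y \<partial>?M)) powr q) \<partial>?M) (1 / q)
      \<le> ennreal (?a powr (- ?e)) * (ennreal (?a powr ?e) * (epowr ?A (1 / q) * epowr ?N (1 / p)))"
    by (rule mult_left_mono) simp
  also have "\<dots> = epowr ?A (1 / q) * epowr ?N (1 / p)"
    using a by (simp add: mult.assoc[symmetric] ennreal_mult[symmetric] powr_add[symmetric])
  finally show "weighted_norm q U (averaging_op \<rho> \<alpha> \<theta> c l f)
      \<le> epowr ?A (1 / q) * weighted_norm p (\<lambda>x. mpowr (V x) (p / q)) f"
    using q by (subst weighted_norm_averaging_op[OF \<rho> l _ U]) (simp_all add: wn)
  assume fin: "?A < \<infinity>"
  have "epowr ?N (1 / p) < \<infinity>" using f by (simp add: weighted_space_def wn)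
  then have "?N < \<infinity>" by (cases ?N) auto
  then have "ennreal (?a powr (q * ?e)) * ?A * epowr ?N (q / p) < \<infinity>"
    using fin by (simp add: ennreal_mult_less_top epowr_less_top)
  then have "kernel_bound ?M q ?X ?Y ?Z f < \<infinity>" using kb by (rule le_less_trans[rotated])
  moreover have "sigma_finite_measure ?M"
    using finite_measure_cube by (rule finite_measure.axioms)
  ultimately have "integrable ?M f"
    using kernel_bound_integrable[OF _ fm meas YZ XX _ emeasure_cube_neq_0[OF l]] by blast
  then show "set_integrable lebesgue (cube c l) f" by (simp add: integral_cube)
qed

section \<open>Averages over cubes: necessity of the weight condition\<close>

lemma averaging_bound_imp_avg_bound:
  fixes U V :: "real ^ 'd \<Rightarrow> complex ^ 'n ^ 'n"
  assumes \<rho>: "critical_radius \<rho>" and p: "1 \<le> p" and pq: "p \<le> q"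
    and U: "matrix_weight U" and V: "matrix_weight V" and l: "0 < l" and C: "0 \<le> C"
    and bound: "\<And>f. f \<in> weighted_space p (\<lambda>x. mpowr (V x) (p / q)) \<Longrightarrow>
      set_integrable lebesgue (cube c l) f \<and> weighted_norm q U (averaging_op \<rho> \<alpha> \<theta> c l f)
        \<le> ennreal C * weighted_norm p (\<lambda>x. mpowr (V x) (p / q)) f"
  shows "avg_bound (lebesgue_on (cube c l)) p q (\<lambda>x. mpowr (U x) (1 / q)) (\<lambda>y. mpowr (V y) (1 / q))
    (C * psi_vol \<rho> \<theta> c l powr (1 - \<alpha> / real CARD('d)))"
  unfolding avg_bound_def
proof (intro ballI impI)
  let ?M = "lebesgue_on (cube c l)"
  let ?X = "\<lambda>x. mpowr (U x) (1 / q)" and ?Z = "\<lambda>y. mpowr (V y) (1 / q)"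
  let ?a = "psi_vol \<rho> \<theta> c l" and ?e = "1 - \<alpha> / real CARD('d)"
  fix g :: "real ^ 'd \<Rightarrow> complex ^ 'n"
  assume g: "g \<in> borel_measurable ?M" and fin: "(\<integral>\<^sup>+ y. ennreal (norm (?Z y *v g y) powr p) \<partial>?M) < \<infinity>"
  \<comment> \<open>Extension by zero makes a function on the cube a test function on the whole
    space, with the same weighted norm and the same average over the cube.\<close>
  define f where "f x = indicator (cube c l) x *\<^sub>R g x" for x
  have a: "0 < ?a" by (rule psi_vol_pos[OF \<rho> l])
  have q: "1 \<le> q" using p pq by simp
  have Q: "cube c l \<inter> space lebesgue \<in> sets lebesgue" using fmeasurableD[OF cube_lmeasurable] by simp
  have "ennreal (norm (?Z y *v f y) powr p) = ennreal (norm (?Z y *v g y) powr p) * indicator (cube c l) y" for y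
    using p by (cases "y \<in> cube c l") (simp_all add: f_def)
  then have N: "(\<integral>\<^sup>+ y. ennreal (norm (?Z y *v f y) powr p) \<partial>lebesgue)
      = (\<integral>\<^sup>+ y. ennreal (norm (?Z y *v g y) powr p) \<partial>?M)"
    unfolding nn_integral_cube by simp
  have wn: "weighted_norm p (\<lambda>x. mpowr (V x) (p / q)) f
      = epowr (\<integral>\<^sup>+ y. ennreal (norm (?Z y *v g y) powr p) \<partial>?M) (1 / p)"
    using p weighted_norm_mpowr[OF V, of p q f] by (simp add: N)
  have "f \<in> borel_measurable lebesgue"
    unfolding f_def using g borel_measurable_restrict_space_iff[OF Q, of g] by simp
  moreover have "weighted_norm p (\<lambda>x. mpowr (V x) (p / q)) f < \<infinity>"
    unfolding wn using fin by (simp add: epowr_less_top)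
  ultimately have "f \<in> weighted_space p (\<lambda>x. mpowr (V x) (p / q))" by (simp add: weighted_space_def)
  note bd = bound[OF this]
  have fg: "f x = g x" if "x \<in> space ?M" for x using that by (simp add: f_def)
  have "integrable ?M f" using bd by (simp add: integral_cube)
  then have int: "integrable ?M g" using Bochner_Integration.integrable_cong[of ?M ?M f g, OF refl fg] by blast
  have eq: "(\<integral>y. f y \<partial>?M) = (\<integral>y. g y \<partial>?M)" using fg by (intro Bochner_Integration.integral_cong) auto
  let ?I = "epowr (\<integral>\<^sup>+ x. ennreal (norm (?X x *v (\<integral>y. g y \<partial>?M)) powr q) \<partial>?M) (1 / q)"
  have "ennreal (?a powr (- ?e)) * ?I \<le> ennreal C * weighted_norm p (\<lambda>x. mpowr (V x) (p / q)) f"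
    using bd q by (simp add: weighted_norm_averaging_op[OF \<rho> l _ U] eq)
  \<comment> \<open>Undoes the normalisation of the average; this is the source of the power of
    \<open>psi_vol\<close> in the constant.\<close>
  from mult_left_mono[OF this, of "ennreal (?a powr ?e)"]
  have "ennreal (?a powr ?e) * (ennreal (?a powr (- ?e)) * ?I)
      \<le> ennreal (?a powr ?e) * (ennreal C * weighted_norm p (\<lambda>x. mpowr (V x) (p / q)) f)" by simp
  moreover have "ennreal (?a powr ?e) * (ennreal (?a powr (- ?e)) * ?I) = ?I"
    using a by (simp add: mult.assoc[symmetric] ennreal_mult[symmetric] powr_add[symmetric])
  moreover have "ennreal (?a powr ?e) * (ennreal C * weighted_norm p (\<lambda>x. mpowr (V x) (p / q)) f)
      = ennreal (C * ?a powr ?e) * weighted_norm p (\<lambda>x. mpowr (V x) (p / q)) f"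
    using C by (simp add: ennreal_mult mult_ac)
  ultimately show "integrable ?M g \<and> ?I \<le> ennreal (C * ?a powr ?e) *
      epowr (\<integral>\<^sup>+ y. ennreal (norm (?Z y *v g y) powr p) \<partial>?M) (1 / p)"
    using int by (simp add: wn)
qed

text \<open>On each cube the abstract bound has constant \<open>C\<close> times a power of
  \<open>psi_vol\<close>. Its \<open>q\<close>-th power cancels the normalisations in the weight
  condition, leaving a number \<open>D\<close> that depends on \<open>n\<close>, \<open>p\<close>,
  \<open>q\<close> and \<open>C\<close> but not on the cube.\<close>

lemma averaging_bound_imp_Apq_class:
  fixes U V :: "real ^ 'd \<Rightarrow> complex ^ 'n ^ 'n"
  assumes \<rho>: "critical_radius \<rho>" and p: "1 \<le> p" and pq: "p \<le> q"
    and \<alpha>: "1 / p - 1 / q = \<alpha> / real CARD('d)"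
    and U: "matrix_weight U" and V: "matrix_weight V" and C: "0 \<le> C"
    and bound: "\<And>c l f. 0 < l \<Longrightarrow> f \<in> weighted_space p (\<lambda>x. mpowr (V x) (p / q)) \<Longrightarrow>
      set_integrable lebesgue (cube c l) f \<and> weighted_norm q U (averaging_op \<rho> \<alpha> \<theta> c l f)
        \<le> ennreal C * weighted_norm p (\<lambda>x. mpowr (V x) (p / q)) f"
  shows "(U, V) \<in> Apq_class \<rho> \<theta> p q"
proof -
  let ?X = "\<lambda>x. mpowr (U x) (1 / q)" and ?Y = "\<lambda>y. mpowr (V y) (- 1 / q)" and ?Z = "\<lambda>y. mpowr (V y) (1 / q)"
  let ?e = "1 - \<alpha> / real CARD('d)" and ?n = "real CARD('n)"
  have q: "1 \<le> q" "0 < q" using p pq by simp_all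
  have facts: "finite_measure M" "?X \<in> borel_measurable M" "?Y \<in> borel_measurable M" "?Z \<in> borel_measurable M"
    "AE y in M. ?Y y ** ?Z y = mat 1" "AE x in M. \<exists>L. L ** ?X x = mat 1"
    if "M = lebesgue_on (cube c l)" for M :: "(real ^ 'd) measure" and c l
    unfolding that
    by (intro finite_measure_cube measurable_restrict_space1 mpowr_weight_measurable U V
        AE_cube weight_AE_inverse eventually_mono[OF AE_cube[OF weight_AE_inverse[OF U]]]; blast)+
  have neq0: "emeasure M (space M) \<noteq> 0" if "M = lebesgue_on (cube c l)" "0 < l"
    for M :: "(real ^ 'd) measure" and c l
    unfolding that(1) by (rule emeasure_cube_neq_0[OF that(2)])
  have avg: "avg_bound M p q ?X ?Z (C * psi_vol \<rho> \<theta> c l powr ?e)"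
    if "M = lebesgue_on (cube c l)" "0 < l" for M c l
    unfolding that(1) by (rule averaging_bound_imp_avg_bound[OF \<rho> p pq U V that(2) C bound[OF that(2)]])
  have powC: "(C * psi_vol \<rho> \<theta> c l powr ?e) powr q = C powr q * psi_vol \<rho> \<theta> c l powr (q * ?e)" if "0 < l" for c l
    using C psi_vol_pos[OF \<rho> that, of \<theta> c] by (simp add: powr_mult powr_powr mult.commute)
  have "\<exists>K. Apq_const \<rho> \<theta> p q U V \<le> ennreal K"
  proof (cases "p = 1")
    case True
    have exp: "q * ?e = 1" using \<alpha>[symmetric] True q by (simp add: field_simps)
    define D where "D = ?n powr (q + 1) * ?n powr q * C powr q"
    have "Apq_const \<rho> \<theta> p q U V \<le> ennreal D"
      unfolding Apq_const_def if_P[OF True]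
    proof (rule SUP_least)
      fix z :: "(real ^ 'd) \<times> real" assume "z \<in> UNIV \<times> {0<..}"
      then obtain c l where z: "z = (c, l)" and l: "0 < l" by auto
      define M where "M = lebesgue_on (cube c l)"
      define a where "a = psi_vol \<rho> \<theta> c l"
      have a: "0 < a" unfolding a_def by (rule psi_vol_pos[OF \<rho> l])
      note F = facts[OF M_def]
      obtain H where H: "integrable M H" "AE x in M. \<forall>v. norm (?X x *v v) powr q \<le> H x * norm v powr q"
        unfolding M_def by (rule weight_dominated[OF U q(2)])
      have A: "AE y in M. (\<integral>\<^sup>+ x. ennreal (matrix_opnorm (?X x ** ?Y y) powr q) \<partial>M)
          \<le> ennreal (?n powr (q + 1) * ?n powr q * (C * a powr ?e) powr q)"
        using avg[OF M_def l] C a unfolding True a_def[symmetric]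
        by (intro avg_bound_imp_A1q[OF F(1-6) H neq0[OF M_def l] q(2)]) auto
      have E: "?n powr (q + 1) * ?n powr q * (C * a powr ?e) powr q = D * a"
        unfolding a_def powC[OF l] exp using a by (simp add: D_def a_def)
      have "AE y in M. ennreal (1 / a) * (\<integral>\<^sup>+ x. ennreal (matrix_opnorm (?X x ** ?Y y) powr q) \<partial>M) \<le> ennreal D"
        using A unfolding E
      proof eventually_elim
        fix y assume "(\<integral>\<^sup>+ x. ennreal (matrix_opnorm (?X x ** ?Y y) powr q) \<partial>M) \<le> ennreal (D * a)"
        from mult_left_mono[OF this, of "ennreal (1 / a)"]
        show "ennreal (1 / a) * (\<integral>\<^sup>+ x. ennreal (matrix_opnorm (?X x ** ?Y y) powr q) \<partial>M) \<le> ennreal D"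
          using a by (simp add: ennreal_mult[symmetric] D_def)
      qed
      \<comment> \<open>Measurability is essential: \<open>esssup\<close> is \<open>top\<close> by
        definition for non-measurable functions.\<close>
      moreover have "(\<lambda>y. ennreal (1 / a) * (\<integral>\<^sup>+ x. ennreal (matrix_opnorm (?X x ** ?Y y) powr q) \<partial>M))
          \<in> borel_measurable M"
      proof -
        interpret finite_measure M by (rule F(1))
        note [measurable] = F(2,3)
        show ?thesis by measurable
      qed
      ultimately have "esssup M (\<lambda>y. ennreal (1 / a) *
          (\<integral>\<^sup>+ x. ennreal (matrix_opnorm (?X x ** ?Y y) powr q) \<partial>M)) \<le> ennreal D"
        by (intro esssup_I)
      then show "(case z of (c, l) \<Rightarrow> esssup (restrict_space lebesgue (cube c l)) (\<lambda>y. ennreal (1 / psi_vol \<rho> \<theta> c l) *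
          (\<integral>\<^sup>+ x \<in> cube c l. ennreal (matrix_opnorm (?X x ** ?Y y) powr q) \<partial>lebesgue))) \<le> ennreal D"
        unfolding z prod.case M_def nn_integral_cube a_def .
    qed
    then show ?thesis by blast
  next
    case False
    then have p1: "1 < p" using p by simp
    define p' where "p' = p / (p - 1)"
    have p': "1 < p'" "1 / p' + 1 / p = 1" using p1 by (simp_all add: p'_def field_simps)
    define e where "e = 1 + q / p'"
    have exp: "q * ?e = e"
    proof -
      have "q * ?e = q * (1 / p' + 1 / q)" using \<alpha> p'(2) by simp
      also have "\<dots> = e" using q by (simp add: e_def distrib_left)
      finally show ?thesis .
    qed
    define D where "D = ?n powr (q + 1) * (?n powr (p' + 1)) powr (q / p') * C powr q"
    have "Apq_const \<rho> \<theta> p q U V \<le> ennreal D"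
      unfolding Apq_const_def if_not_P[OF False] Let_def p'_def[symmetric]
    proof (rule SUP_least)
      fix z :: "(real ^ 'd) \<times> real" assume "z \<in> UNIV \<times> {0<..}"
      then obtain c l where z: "z = (c, l)" and l: "0 < l" by auto
      define M where "M = lebesgue_on (cube c l)"
      define a where "a = psi_vol \<rho> \<theta> c l"
      have a: "0 < a" unfolding a_def by (rule psi_vol_pos[OF \<rho> l])
      note F = facts[OF M_def]
      interpret finite_measure M by (rule F(1))
      note [measurable] = F(2,3)
      obtain H where H: "integrable M H" "AE x in M. \<forall>v. norm (?X x *v v) powr q \<le> H x * norm v powr q"
        unfolding M_def by (rule weight_dominated[OF U q(2)])
      let ?J = "\<integral>\<^sup>+ x. epowr (\<integral>\<^sup>+ y. ennreal (matrix_opnorm (?X x ** ?Y y) powr p') \<partial>M) (q / p') \<partial>M"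
      have "?J \<le> ennreal (?n powr (q + 1) * (?n powr (p' + 1)) powr (q / p') * (C * a powr ?e) powr q)"
        using avg[OF M_def l] C a unfolding a_def[symmetric]
        by (intro avg_bound_imp_Apq[OF F(1-6) H neq0[OF M_def l] q(2) p1 p']) auto
      also have "?n powr (q + 1) * (?n powr (p' + 1)) powr (q / p') * (C * a powr ?e) powr q = D * a powr e"
        unfolding a_def powC[OF l] exp by (simp add: D_def)
      finally have J: "?J \<le> ennreal (D * a powr e)" .
      have "ennreal (1 / a) * (\<integral>\<^sup>+ x. epowr (ennreal (1 / a) *
          (\<integral>\<^sup>+ y. ennreal (matrix_opnorm (?X x ** ?Y y) powr p') \<partial>M)) (q / p') \<partial>M)
          = ennreal (1 / a) * (ennreal ((1 / a) powr (q / p')) * ?J)"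
        unfolding epowr_mult by (subst nn_integral_cmult, measurable) (use a in \<open>simp add: epowr_ennreal\<close>)
      also have "\<dots> = ennreal (1 / a powr e) * ?J"
        using a by (simp add: e_def mult.assoc[symmetric] ennreal_mult[symmetric] powr_add powr_divide)
      also have "\<dots> \<le> ennreal (1 / a powr e) * ennreal (D * a powr e)"
        by (rule mult_left_mono[OF J]) simp
      also have "\<dots> = ennreal D" using a by (simp add: ennreal_mult[symmetric] D_def)
      finally show "(case z of (c, l) \<Rightarrow> ennreal (1 / psi_vol \<rho> \<theta> c l) * (\<integral>\<^sup>+ x \<in> cube c l. epowr (ennreal (1 / psi_vol \<rho> \<theta> c l) *
          (\<integral>\<^sup>+ y \<in> cube c l. ennreal (matrix_opnorm (?X x ** ?Y y) powr p') \<partial>lebesgue)) (q / p') \<partial>lebesgue))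
          \<le> ennreal D"
        unfolding z prod.case M_def nn_integral_cube a_def .
    qed
    then show ?thesis by blast
  qed
  then show ?thesis by (auto simp: Apq_class_def intro: le_less_trans)
qed

text \<open>The averaging inequality is paired with integrability of \<open>f\<close> on the cube,
  because the formal average of a non-integrable \<open>f\<close> is \<open>0\<close>; the passage
  back to the weight condition relies on this clause through \<open>avg_bound\<close>.\<close>

theorem theorem1p14:
  fixes \<rho> :: "real ^ 'd \<Rightarrow> real" and \<theta> \<alpha> p q :: real
  assumes "critical_radius \<rho>"
    and "0 \<le> \<theta>"
    and "0 \<le> \<alpha>" and "\<alpha> < real CARD('d)"
    and "1 \<le> p" and "p \<le> q"
    and "1 / p - 1 / q = \<alpha> / real CARD('d)"
  shows
    "(\<forall>U V :: real ^ 'd \<Rightarrow> complex ^ 'n ^ 'n. matrix_weight U \<longrightarrow> matrix_weight V \<longrightarrow>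
        ((U, V) \<in> Apq_class \<rho> \<theta> p q \<longleftrightarrow>
         (\<exists>C \<ge> 0. \<forall>c. \<forall>l > 0. \<forall>f \<in> weighted_space p (\<lambda>x. mpowr (V x) (p / q)).
            set_integrable lebesgue (cube c l) f \<and>
            weighted_norm q U (averaging_op \<rho> \<alpha> \<theta> c l f)
              \<le> ennreal C * weighted_norm p (\<lambda>x. mpowr (V x) (p / q)) f))) \<and>
     (\<exists>C \<ge> 0. \<forall>U V :: real ^ 'd \<Rightarrow> complex ^ 'n ^ 'n. matrix_weight U \<longrightarrow> matrix_weight V \<longrightarrow>
        (\<forall>c. \<forall>l > 0. \<forall>f \<in> weighted_space p (\<lambda>x. mpowr (V x) (p / q)).
            weighted_norm q U (averaging_op \<rho> \<alpha> \<theta> c l f)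
              \<le> ennreal C * epowr (Apq_const \<rho> \<theta> p q U V) (1 / q)
                  * weighted_norm p (\<lambda>x. mpowr (V x) (p / q)) f))"
proof (intro conjI allI impI)
  fix U V :: "real ^ 'd \<Rightarrow> complex ^ 'n ^ 'n"
  assume U: "matrix_weight U" and V: "matrix_weight V"
  note bound = averaging_op_bound[OF assms(1,5,6,7) U V]
  let ?bounded = "\<lambda>C. \<forall>c. \<forall>l > 0. \<forall>f \<in> weighted_space p (\<lambda>x. mpowr (V x) (p / q)).
      set_integrable lebesgue (cube c l) f \<and> weighted_norm q U (averaging_op \<rho> \<alpha> \<theta> c l f)
        \<le> ennreal C * weighted_norm p (\<lambda>x. mpowr (V x) (p / q)) f"
  show "(U, V) \<in> Apq_class \<rho> \<theta> p q \<longleftrightarrow> (\<exists>C \<ge> 0. ?bounded C)"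
  proof
    assume "(U, V) \<in> Apq_class \<rho> \<theta> p q"
    then have fin: "Apq_const \<rho> \<theta> p q U V < \<infinity>" by (simp add: Apq_class_def)
    define C where "C = enn2real (epowr (Apq_const \<rho> \<theta> p q U V) (1 / q))"
    have "ennreal C = epowr (Apq_const \<rho> \<theta> p q U V) (1 / q)"
      unfolding C_def using fin by (simp add: epowr_less_top)
    then have "?bounded C" using bound fin by simp
    moreover have "0 \<le> C" by (simp add: C_def)
    ultimately show "\<exists>C \<ge> 0. ?bounded C" by blast
  next
    assume "\<exists>C \<ge> 0. ?bounded C"
    then obtain C where "0 \<le> C" "?bounded C" by blast
    then show "(U, V) \<in> Apq_class \<rho> \<theta> p q"
      by (intro averaging_bound_imp_Apq_class[OF assms(1,5,6,7) U V]) auto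
  qed
next
  show "\<exists>C \<ge> 0. \<forall>U V :: real ^ 'd \<Rightarrow> complex ^ 'n ^ 'n. matrix_weight U \<longrightarrow> matrix_weight V \<longrightarrow>
        (\<forall>c. \<forall>l > 0. \<forall>f \<in> weighted_space p (\<lambda>x. mpowr (V x) (p / q)).
            weighted_norm q U (averaging_op \<rho> \<alpha> \<theta> c l f)
              \<le> ennreal C * epowr (Apq_const \<rho> \<theta> p q U V) (1 / q)
                  * weighted_norm p (\<lambda>x. mpowr (V x) (p / q)) f)"
    \<comment> \<open>The witness \<open>1\<close> works for all weights at once, since
      \<open>averaging_op_bound\<close> has no further constant.\<close>
    using averaging_op_bound(1)[OF assms(1,5,6,7)] by (intro exI[of _ 1]) auto
qed

end
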